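(* Let $H$ be a finite-dimensional real Hilbert space, $A\in B(H,H)$ symmetric with $\|A^{1/2}\mathbf{u}\|^2\ge\ell_0\|\mathbf{u}\|^2$ for all $\mathbf{u}$ ($\ell_0>0$), $\mathbf{N}:H\to H$ locally Lipschitz with $\mathbf{N}(\mathbf{u})\cdot\mathbf{u}=0$ for all $\mathbf{u}$, $\mathbf{F}\in H$ constant, and $\gamma>0$. Let $S$ be the solution semigroup of $\frac{d\mathbf{u}}{dt}+A\mathbf{u}+\mathbf{N}(\mathbf{u})=\mathbf{F}$ on $H$, and $S_q$ the solution semigroup of the augmented system $\frac{d\mathbf{u}}{dt}+A\mathbf{u}+q\mathbf{N}(\mathbf{u})=\mathbf{F}$, $\frac{dq}{dt}-\mathbf{N}(\mathbf{u})\cdot\mathbf{u}=-\gamma q+\gamma$ on $H\times\mathbb{R}$. For $k\in(0,1]$ let $\mathbb{S}_k((\mathbf{u}_0,\mathbf{u}_1),(q_0,q_1))=((\mathbf{u}_1,\mathbf{u}_2),(q_1,q_2))$ on $(H\times H)\times\mathbb{R}^2$, where $(\mathbf{u}_2,q_2)$ is the unique solution of $$\frac{3\mathbf{u}_2-4\mathbf{u}_1+\mathbf{u}_0}{2k}+A\mathbf{u}_2+q_2\mathbf{N}(2\mathbf{u}_1-\mathbf{u}_0)=\mathbf{F},\qquad \frac{3q_2-4q_1+q_0}{2k}+\gamma q_2-\mathbf{N}(2\mathbf{u}_1-\mathbf{u}_0)\cdot\mathbf{u}_2=\gamma.$$ For each $k$ let $\mu_k$ be an invariant probability measure of $\mathbb{S}_k$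 on $(H\times H)\times\mathbb{R}^2$. Then as $k\to0$, $\{\mu_k\}$ contains a subsequence, still denoted $\{\mu_k\}$, that converges weakly to a probability measure $\mu_0$ on $(H\times H)\times\mathbb{R}^2$. Moreover, for $j=1,2$, $\mathcal{P}_j^*\mu_0$ is an invariant measure of $S_q$, and $$\mathcal{P}_u^*\mathcal{P}_j^*\mu_k\rightharpoonup\mathcal{P}_u^*\mathcal{P}_j^*\mu_0\in\mathcal{IM}(S),$$ where $\mathcal{IM}(S)$ is the set of invariant measures of $S$.
   Context: A Borel probability measure $\mu$ is invariant under a map $T$ if $\mu(T^{-1}B)=\mu(B)$ for all Borel sets $B$; it is invariant under a semigroup $S(t)$ if this holds for $T=S(t)$ for every $t\ge0$. Weak convergence of probability measures means convergence of integrals of bounded continuous functions. $\mathcal{P}_j((\mathbf{u}_1,\mathbf{u}_2),(q_1,q_2))=(\mathbf{u}_j,q_j)\in H\times\mathbb{R}$, $\mathcal{P}_u(\mathbf{u},q)=\mathbf{u}$, and $\mathcal{P}^*$ denotes the induced push-forward (marginal) map on probability measures: $(\mathcal{P}^*\mu)(\Omega)=\mu(\mathcal{P}^{-1}(\Omega))$. *)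

theory Defs
  imports "HOL-Probability.Probability"
begin

definition locally_lipschitz :: "('a::metric_space \<Rightarrow> 'b::metric_space) \<Rightarrow> bool" where
  "locally_lipschitz f \<longleftrightarrow>
     (\<forall>x. \<exists>e>0. \<exists>L. \<forall>y\<in>ball x e. \<forall>z\<in>ball x e. dist (f y) (f z) \<le> L * dist y z)"

definition borel_prob :: "'a::topological_space measure \<Rightarrow> bool" where
  "borel_prob \<mu> \<longleftrightarrow> prob_space \<mu> \<and> sets \<mu> = sets borel"

definition invariant_map :: "('a::topological_space \<Rightarrow> 'a) \<Rightarrow> 'a measure \<Rightarrow> bool" where
  "invariant_map T \<mu> \<longleftrightarrow> borel_prob \<mu> \<and>
     (\<forall>B\<in>sets borel. emeasure \<mu> (T -` B) = emeasure \<mu> B)"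

definition invariant_semigroup :: "(real \<Rightarrow> 'a::topological_space \<Rightarrow> 'a) \<Rightarrow> 'a measure \<Rightarrow> bool" where
  "invariant_semigroup S \<mu> \<longleftrightarrow> (\<forall>t\<ge>0. invariant_map (S t) \<mu>)"

definition weak_conv :: "(nat \<Rightarrow> 'a::topological_space measure) \<Rightarrow> 'a measure \<Rightarrow> bool" where
  "weak_conv M M0 \<longleftrightarrow>
     (\<forall>f::'a \<Rightarrow> real. continuous_on UNIV f \<and> bounded (range f) \<longrightarrow>
        (\<lambda>n. integral\<^sup>L (M n) f) \<longlonglongrightarrow> integral\<^sup>L M0 f)"

definition bdf2_map ::
  "('a::euclidean_space \<Rightarrow> 'a) \<Rightarrow> ('a \<Rightarrow> 'a) \<Rightarrow> 'a \<Rightarrow> real \<Rightarrow> real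
   \<Rightarrow> ('a \<times> 'a) \<times> (real \<times> real) \<Rightarrow> ('a \<times> 'a) \<times> (real \<times> real)" where
  "bdf2_map A N F \<gamma> k x =
     (case x of ((u0, u1), (q0, q1)) \<Rightarrow>
       (case (THE (u2, q2). 
              (1 / (2 * k)) *\<^sub>R (3 *\<^sub>R u2 - 4 *\<^sub>R u1 + u0) + A u2 + q2 *\<^sub>R N (2 *\<^sub>R u1 - u0) = F
            \<and> (3 * q2 - 4 * q1 + q0) / (2 * k) + \<gamma> * q2 - N (2 *\<^sub>R u1 - u0) \<bullet> u2 = \<gamma>)
        of (u2, q2) \<Rightarrow> ((u1, u2), (q1, q2))))"

definition P1 :: "('a \<times> 'a) \<times> (real \<times> real) \<Rightarrow> 'a \<times> real" where
  "P1 x = (fst (fst x), fst (snd x))"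
definition P2 :: "('a \<times> 'a) \<times> (real \<times> real) \<Rightarrow> 'a \<times> real" where
  "P2 x = (snd (fst x), snd (snd x))"
definition Pu :: "'a \<times> real \<Rightarrow> 'a" where
  "Pu x = fst x"

end

theory Submission
  imports Defs
begin

text \<open>
  Testing the scheme with its newest iterate cancels the nonlinear terms and makes a BDF2 energy
  contract towards a fixed level by a factor $1 + \beta k$ per step. An invariant measure cannot
  charge the region where a function contracts in this way, so all \<open>\<mu> k\<close> live on one
  compact set; the same argument applied to the increment shows that it is $O(k)$ almost surely.
  Hence a subsequence converges weakly. For $z_j = (u_j, q_j)$ the combination
  $y = (3 z_1 - z_0)/2$ turns the two-step scheme into an explicit Euler step with an error of
  order $k^2$, so on finite time intervals $y$ follows the flow \<open>Sq\<close> uniformly on the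
  support, and the law of $y$ under the limit is invariant under \<open>Sq\<close>. There the increments
  vanish, so $y$ agrees with both projections. Finally $q - 1$ decays exponentially along
  \<open>Sq\<close>, so invariance forces $q = 1$, where \<open>Sq\<close> reduces to \<open>S\<close>.
\<close>

section \<open>Weak compactness on a compact set\<close>

lemma ternary_expansion_separation:
  fixes c :: "nat \<Rightarrow> real"
  assumes c: "\<And>i. \<bar>c i\<bar> \<le> (2/3) * (1/3) ^ i" and zero: "\<And>i. i < m \<Longrightarrow> c i = 0"
    and cm: "\<bar>c m\<bar> = (2/3) * (1/3) ^ m"
  shows "(1/3) ^ Suc m \<le> \<bar>suminf c\<bar>"
proof -
  have geo: "summable (\<lambda>i. (2/3) * (1/3::real) ^ i)"
    by (intro summable_mult summable_geometric) auto
  have sc: "summable (\<lambda>i. \<bar>c i\<bar>)"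
    by (rule summable_comparison_test'[OF geo]) (use c in auto)
  then have sc': "summable c" by (rule summable_rabs_cancel)
  have sum_geo: "(\<Sum>n. (2/3) * (1/3::real) ^ (n + Suc m)) = (1/3) ^ Suc m"
  proof -
    have "(\<lambda>n. (2/3) * (1/3) ^ Suc m * (1/3::real) ^ n) sums ((2/3) * (1/3) ^ Suc m * (1 / (1 - 1/3)))"
      by (intro sums_mult geometric_sums) simp
    then show ?thesis by (simp add: sums_iff power_add ac_simps)
  qed
  have "\<bar>\<Sum>n. c (n + Suc m)\<bar> \<le> (\<Sum>n. \<bar>c (n + Suc m)\<bar>)"
    by (rule summable_rabs) (use sc summable_iff_shift[of "\<lambda>i. \<bar>c i\<bar>" "Suc m"] in blast)
  also have "\<dots> \<le> (\<Sum>n. (2/3) * (1/3::real) ^ (n + Suc m))"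
    by (intro suminf_le c)
      (use sc geo summable_iff_shift[of "\<lambda>i. \<bar>c i\<bar>" "Suc m"]
           summable_iff_shift[of "\<lambda>i. (2/3) * (1/3::real) ^ i" "Suc m"] in blast)+
  finally have tail: "\<bar>\<Sum>n. c (n + Suc m)\<bar> \<le> (1/3) ^ Suc m"
    unfolding sum_geo .
  have "suminf c = (\<Sum>n. c (n + Suc m)) + c m"
    using suminf_split_initial_segment[OF sc', of "Suc m"] zero by simp
  then show ?thesis
    using tail cm by (simp add: abs_if split: if_splits)
qed

text \<open>
  The code of a point lists, as ternary digits 0 and 2, its memberships in a countable base.
  Decoding is uniformly continuous on the codes, so Helly's selection theorem on the line
  transfers to the compact set.
\<close>

lemma compact_ternary_code:
  fixes K :: "'a::{second_countable_topology, metric_space} set"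
  assumes "compact K"
  obtains s :: "'a \<Rightarrow> real" where "s \<in> borel_measurable borel" "\<And>x. 0 \<le> s x" "\<And>x. s x \<le> 1"
    "\<And>e. e > 0 \<Longrightarrow> \<exists>d>0. \<forall>x\<in>K. \<forall>y\<in>K. \<bar>s x - s y\<bar> < d \<longrightarrow> dist x y < e"
proof -
  obtain B :: "'a set set" where B: "countable B" "topological_basis B"
    using ex_countable_basis by blast
  define b where "b = from_nat_into (insert {} B)"
  have range_b: "range b = insert {} B"
    unfolding b_def by (rule range_from_nat_into) (use B in auto)
  have open_b: "open (b m)" for m
    using range_b topological_basis_open[OF B(2)] by (metis insert_iff open_empty rangeI)
  define a where "a x m = (2/3) * (1/3) ^ m * (indicator (b m) x :: real)" for x m
  define s where "s x = suminf (a x)" for x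
  have geo: "summable (\<lambda>i. (2/3) * (1/3::real) ^ i)"
    by (intro summable_mult summable_geometric) auto
  have a: "0 \<le> a x i" "a x i \<le> (2/3) * (1/3) ^ i" for x i
    by (auto simp: a_def indicator_def)
  have sa: "summable (a x)" for x
    by (rule summable_comparison_test'[OF geo]) (use a in auto)
  have meas: "s \<in> borel_measurable borel"
    unfolding s_def a_def using open_b by (measurable; simp)
  have ge: "0 \<le> s x" for x
    unfolding s_def by (rule suminf_nonneg[OF sa a(1)])
  have le: "s x \<le> 1" for x
  proof -
    have "s x \<le> (\<Sum>i. (2/3) * (1/3::real) ^ i)"
      unfolding s_def by (rule suminf_le[OF a(2) sa geo])
    also have "\<dots> = 1" by (simp add: suminf_mult suminf_divide suminf_geometric summable_geometric)
    finally show ?thesis .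
  qed
  have sep: "(1/3) ^ Suc m \<le> \<bar>s x - s y\<bar>"
    if "\<And>i. i < m \<Longrightarrow> x \<in> b i \<longleftrightarrow> y \<in> b i" "x \<in> b m \<longleftrightarrow> y \<notin> b m" for x y m
  proof -
    have eq: "s x - s y = (\<Sum>i. a x i - a y i)"
      unfolding s_def by (rule suminf_diff[OF sa sa])
    show ?thesis unfolding eq
    proof (rule ternary_expansion_separation)
      show "\<bar>a x i - a y i\<bar> \<le> (2/3) * (1/3) ^ i" for i
        by (auto simp: a_def indicator_def)
      show "a x i - a y i = 0" if "i < m" for i
        using \<open>\<And>i. i < m \<Longrightarrow> x \<in> b i \<longleftrightarrow> y \<in> b i\<close>[OF that] by (simp add: a_def indicator_def)
      show "\<bar>a x m - a y m\<bar> = (2/3) * (1/3) ^ m"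
        using that(2) by (auto simp: a_def indicator_def)
    qed
  qed
  have unif: "\<exists>d>0. \<forall>x\<in>K. \<forall>y\<in>K. \<bar>s x - s y\<bar> < d \<longrightarrow> dist x y < e" if "e > 0" for e
  proof -
    define I where "I = {m. \<forall>y\<in>b m. \<forall>z\<in>b m. dist y z < e}"
    have "K \<subseteq> (\<Union>m\<in>I. b m)"
    proof
      fix x assume "x \<in> K"
      obtain U where U: "U \<in> B" "x \<in> U" "U \<subseteq> ball x (e/2)"
        using topological_basisE[OF B(2), of "ball x (e/2)" x] \<open>e > 0\<close> by auto
      then obtain m where "b m = U" using range_b by (metis insertI2 rangeE)
      moreover have "dist y z < e" if "y \<in> U" "z \<in> U" for y z
        using that subsetD[OF U(3), of y] subsetD[OF U(3), of z] dist_triangle_half_r[of x y e z] by auto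
      ultimately show "x \<in> (\<Union>m\<in>I. b m)" using U by (auto simp: I_def)
    qed
    then obtain J where J: "J \<subseteq> I" "finite J" "K \<subseteq> (\<Union>m\<in>J. b m)"
      using compactE_image[OF assms, of I b] open_b by metis
    obtain m where m: "\<forall>i\<in>J. i < m" using finite_nat_set_iff_bounded J(2) by blast
    have "dist x y < e" if "x \<in> K" "y \<in> K" "\<bar>s x - s y\<bar> < (1/3) ^ m" for x y
    proof -
      have agree: "x \<in> b i \<longleftrightarrow> y \<in> b i" if "i < m" for i
        using that
      proof (induction i rule: less_induct)
        case (less i)
        have "\<not> (x \<in> b i \<longleftrightarrow> y \<notin> b i)"
        proof
          assume "x \<in> b i \<longleftrightarrow> y \<notin> b i"
          then have "(1/3) ^ Suc i \<le> \<bar>s x - s y\<bar>" using less by (intro sep) auto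
          moreover have "(1/3::real) ^ m \<le> (1/3) ^ Suc i"
            using less.prems by (intro power_decreasing) auto
          ultimately show False using \<open>\<bar>s x - s y\<bar> < (1/3) ^ m\<close> by linarith
        qed
        then show ?case by blast
      qed
      obtain i where "i \<in> J" "x \<in> b i" using J(3) \<open>x \<in> K\<close> by blast
      then show ?thesis using agree[of i] m J(1) by (auto simp: I_def)
    qed
    then show ?thesis by (intro exI[of _ "(1/3) ^ m"]) auto
  qed
  show ?thesis using that[OF meas ge le unif] by blast
qed

lemma weak_conv_subsequence_compact:
  fixes M :: "nat \<Rightarrow> 'a::euclidean_space measure"
  assumes M: "\<And>n. borel_prob (M n)" and K: "compact K" and MK: "\<And>n. AE x in M n. x \<in> K"
  obtains r M0 where "strict_mono (r :: nat \<Rightarrow> nat)" "borel_prob M0" "weak_conv (\<lambda>n. M (r n)) M0"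
proof -
  obtain s :: "'a \<Rightarrow> real" where s: "s \<in> borel_measurable borel" "\<And>x. 0 \<le> s x" "\<And>x. s x \<le> 1"
    and s_unif: "\<And>e. e > 0 \<Longrightarrow> \<exists>d>0. \<forall>x\<in>K. \<forall>y\<in>K. \<bar>s x - s y\<bar> < d \<longrightarrow> dist x y < e"
    using compact_ternary_code[OF K] by metis
  have inj: "inj_on s K"
  proof (rule inj_onI, rule ccontr)
    fix x y assume xy: "x \<in> K" "y \<in> K" "s x = s y" "x \<noteq> y"
    then obtain d where "d > 0" "\<forall>x\<in>K. \<forall>y'\<in>K. \<bar>s x - s y'\<bar> < d \<longrightarrow> dist x y' < dist x y"
      using s_unif[of "dist x y"] by (metis zero_less_dist_iff order_less_irrefl abs_zero diff_self)
    then show False using xy by force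
  qed
  have "uniformly_continuous_on (s ` K) (inv_into K s)"
    unfolding uniformly_continuous_on_def
  proof (intro allI impI)
    fix e :: real assume "e > 0"
    then obtain d where "d > 0" "\<forall>x\<in>K. \<forall>y\<in>K. \<bar>s x - s y\<bar> < d \<longrightarrow> dist x y < e"
      using s_unif by blast
    then show "\<exists>d>0. \<forall>x\<in>s ` K. \<forall>x'\<in>s ` K. dist x' x < d \<longrightarrow> dist (inv_into K s x') (inv_into K s x) < e"
      using inj by (intro exI[of _ d]) (auto simp: dist_real_def)
  qed
  then obtain g where g: "uniformly_continuous_on (closure (s ` K)) g"
      "\<And>x. x \<in> s ` K \<Longrightarrow> inv_into K s x = g x"
    by (rule uniformly_continuous_on_extension_on_closure) blast
  obtain \<psi> where \<psi>: "continuous_on UNIV \<psi>" "\<And>x. x \<in> closure (s ` K) \<Longrightarrow> \<psi> x = g x"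
    using Dugundji[of UNIV UNIV "closure (s ` K)" g] uniformly_continuous_imp_continuous[OF g(1)]
    by auto
  have \<psi>s: "\<psi> (s x) = x" if "x \<in> K" for x
  proof -
    have "s x \<in> closure (s ` K)" by (rule subsetD[OF closure_subset imageI[OF that]])
    then have "\<psi> (s x) = inv_into K s (s x)" using \<psi>(2) g(2)[OF imageI[OF that]] by metis
    then show ?thesis using inv_into_f_f[OF inj that] by (rule trans)
  qed
  have \<psi>_meas [measurable]: "\<psi> \<in> borel_measurable borel"
    by (rule borel_measurable_continuous_onI[OF \<psi>(1)])
  define \<nu> where "\<nu> n = distr (M n) borel s" for n
  have sM: "sets (M n) = sets borel" and pM: "prob_space (M n)" for n
    using M unfolding borel_prob_def by auto
  note sM[measurable_cong] s(1)[measurable]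
  have \<nu>: "real_distribution (\<nu> n)" for n
    unfolding \<nu>_def by (rule prob_space.real_distribution_distr[OF pM]) measurable
  have "tight \<nu>"
    unfolding tight_def
  proof (intro conjI allI impI \<nu>)
    fix \<epsilon> :: real assume "\<epsilon> > 0"
    have "measure (\<nu> n) {-1<..1} = 1" for n
    proof -
      have "-1 < s x" for x using s(2)[of x] by linarith
      then have "s -` {-1<..1} = UNIV" using s(3) by auto
      then show ?thesis
        using prob_space.prob_space[OF pM[of n]] sets_eq_imp_space_eq[OF sM, of n]
        by (simp add: \<nu>_def measure_distr)
    qed
    then show "\<exists>a b. a < b \<and> (\<forall>n. 1 - \<epsilon> < measure (\<nu> n) {a<..b})"
      using \<open>\<epsilon> > 0\<close> by (intro exI[of _ "-1"] exI[of _ 1]) auto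
  qed
  then obtain r N where r: "strict_mono (r :: nat \<Rightarrow> nat)" "real_distribution N"
      "weak_conv_m (\<nu> \<circ> id \<circ> r) N"
    using tight_imp_convergent_subsubsequence[of \<nu> id] by (auto simp: strict_mono_def)
  define M0 where "M0 = distr N borel \<psi>"
  interpret N: real_distribution N by fact
  have "borel_prob M0"
    unfolding borel_prob_def M0_def by (auto intro!: N.prob_space_distr)
  moreover have "weak_conv (\<lambda>n. M (r n)) M0"
    unfolding weak_conv_def
  proof (intro allI impI, elim conjE)
    fix f :: "'a \<Rightarrow> real" assume f: "continuous_on UNIV f" "bounded (range f)"
    have [measurable]: "f \<in> borel_measurable borel"
      by (rule borel_measurable_continuous_onI[OF f(1)])
    obtain B where B: "\<And>x. norm (f x) \<le> B" using f(2) unfolding bounded_iff by auto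
    have "continuous_on UNIV (\<lambda>x. f (\<psi> x))"
      using continuous_on_compose2[OF f(1) \<psi>(1)] by auto
    then have "isCont (\<lambda>x. f (\<psi> x)) x" for x
      by (simp add: continuous_on_eq_continuous_at)
    then have "(\<lambda>n. integral\<^sup>L ((\<nu> \<circ> id \<circ> r) n) (\<lambda>x. f (\<psi> x))) \<longlonglongrightarrow> integral\<^sup>L N (\<lambda>x. f (\<psi> x))"
      by (intro weak_conv_imp_integral_bdd_continuous_conv[OF _ r(2,3), where B=B] B) (auto simp: \<nu>)
    moreover have "integral\<^sup>L (\<nu> n) (\<lambda>x. f (\<psi> x)) = integral\<^sup>L (M n) f" for n
    proof -
      have "integral\<^sup>L (\<nu> n) (\<lambda>x. f (\<psi> x)) = integral\<^sup>L (M n) (\<lambda>x. f (\<psi> (s x)))"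
        unfolding \<nu>_def by (rule integral_distr) measurable
      also have "\<dots> = integral\<^sup>L (M n) f"
        by (rule integral_cong_AE) (use MK[of n] \<psi>s in \<open>auto elim!: eventually_mono\<close>)
      finally show ?thesis .
    qed
    moreover have "integral\<^sup>L N (\<lambda>x. f (\<psi> x)) = integral\<^sup>L M0 f"
      unfolding M0_def by (rule integral_distr[symmetric]) auto
    ultimately show "(\<lambda>n. integral\<^sup>L (M (r n)) f) \<longlonglongrightarrow> integral\<^sup>L M0 f" by simp
  qed
  ultimately show ?thesis using that r(1) by blast
qed

lemma borel_prob_eqI:
  fixes M M' :: "'a::metric_space measure"
  assumes "borel_prob M" "borel_prob M'"
    and eq: "\<And>f::'a \<Rightarrow> real. continuous_on UNIV f \<Longrightarrow> bounded (range f) \<Longrightarrow> integral\<^sup>L M f = integral\<^sup>L M' f"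
  shows "M = M'"
proof -
  have sM: "sets M = sets borel" "sets M' = sets borel" using assms unfolding borel_prob_def by auto
  interpret M: prob_space M using assms unfolding borel_prob_def by auto
  interpret M': prob_space M' using assms unfolding borel_prob_def by auto
  have space: "space M = UNIV" "space M' = UNIV" using sets_eq_imp_space_eq[OF sM(1)] sets_eq_imp_space_eq[OF sM(2)] by simp_all
  note sM[measurable_cong]
  have closed_eq: "emeasure M C = emeasure M' C" if "closed C" for C
  proof (cases "C = {}")
    case False
    have [measurable]: "C \<in> sets borel" using that by simp
    define f where "f n x = max 0 (1 - real n * infdist x C)" for n x
    have cf: "continuous_on UNIV (f n)" for n unfolding f_def by (intro continuous_intros)
    have f01: "\<bar>f n x\<bar> \<le> 1" for n x unfolding f_def using infdist_nonneg[of x C] by (auto simp: max_def)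
    have bf: "bounded (range (f n))" for n using f01 unfolding bounded_iff by auto
    have [measurable]: "f n \<in> borel_measurable borel" for n
      by (rule borel_measurable_continuous_onI[OF cf])
    have lim: "(\<lambda>n. f n x) \<longlonglongrightarrow> indicator C x" for x
    proof (cases "x \<in> C")
      case True
      then show ?thesis by (simp add: f_def)
    next
      case nx: False
      then have pos: "infdist x C > 0"
        using that False infdist_nonneg[of x C] in_closed_iff_infdist_zero[of C x] by linarith
      obtain n0 where n0: "1 / infdist x C < real n0" using reals_Archimedean2 by blast
      have "f n x = 0" if "n \<ge> n0" for n
      proof -
        have "1 / infdist x C < real n" using n0 that by linarith
        then show ?thesis using pos by (simp add: f_def field_simps)
      qed
      then show ?thesis using nx by (auto intro!: tendsto_eventually eventually_sequentiallyI[of n0])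
    qed
    have "(\<lambda>n. integral\<^sup>L M (f n)) \<longlonglongrightarrow> integral\<^sup>L M (indicator C)"
      by (rule integral_dominated_convergence[where w="\<lambda>_. 1"]) (use lim f01 in auto)
    moreover have "(\<lambda>n. integral\<^sup>L M' (f n)) \<longlonglongrightarrow> integral\<^sup>L M' (indicator C)"
      by (rule integral_dominated_convergence[where w="\<lambda>_. 1"]) (use lim f01 in auto)
    ultimately have "integral\<^sup>L M (indicator C :: 'a \<Rightarrow> real) = integral\<^sup>L M' (indicator C)"
      using eq[OF cf bf] LIMSEQ_unique by auto
    then show ?thesis by (simp add: space M.emeasure_eq_measure M'.emeasure_eq_measure)
  qed simp
  show ?thesis
  proof (rule measure_eqI_generator_eq[where E="Collect closed" and \<Omega>=UNIV and A="\<lambda>_. UNIV"])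
    show "Int_stable (Collect closed)" by (auto simp: Int_stable_def)
    show "sets M = sigma_sets UNIV (Collect closed)" "sets M' = sigma_sets UNIV (Collect closed)"
      using sM by (auto simp: borel_eq_closed)
  qed (use closed_eq in auto)
qed

section \<open>Invariant measures\<close>

lemma borel_probD:
  assumes "borel_prob \<mu>"
  shows "prob_space \<mu>" "sets \<mu> = sets borel" "space \<mu> = UNIV"
  using assms sets_eq_imp_space_eq[of \<mu> borel] by (auto simp: borel_prob_def)

lemma borel_prob_distr:
  assumes "borel_prob \<mu>" "f \<in> borel_measurable borel"
  shows "borel_prob (distr \<mu> borel f)"
  using assms borel_probD[OF assms(1)] measurable_cong_sets[of \<mu> borel borel borel]
  unfolding borel_prob_def by (auto intro: prob_space.prob_space_distr)

lemma invariant_map_iff_distr: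
  assumes \<mu>: "borel_prob \<mu>" and T: "T \<in> borel_measurable borel"
  shows "invariant_map T \<mu> \<longleftrightarrow> distr \<mu> borel T = \<mu>"
proof -
  note b = borel_probD[OF \<mu>]
  have T': "T \<in> borel_measurable \<mu>" using T b measurable_cong_sets by blast
  have eq: "emeasure (distr \<mu> borel T) B = emeasure \<mu> (T -` B)" if "B \<in> sets borel" for B
    using that T' by (simp add: emeasure_distr b)
  show ?thesis
  proof
    assume "invariant_map T \<mu>"
    then show "distr \<mu> borel T = \<mu>"
      by (intro measure_eqI) (auto simp: b eq invariant_map_def)
  next
    assume "distr \<mu> borel T = \<mu>"
    then show "invariant_map T \<mu>" using eq \<mu> by (auto simp: invariant_map_def)
  qed
qed

lemma invariant_map_AE_compose:
  assumes "invariant_map T \<mu>" "T \<in> borel_measurable borel" "AE x in \<mu>. P x"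
  shows "AE x in \<mu>. P (T x)"
proof -
  have \<mu>: "borel_prob \<mu>" using assms(1) by (simp add: invariant_map_def)
  have "distr \<mu> borel T = \<mu>" using invariant_map_iff_distr[OF \<mu>] assms by simp
  then have "AE x in distr \<mu> borel T. P x" using assms(3) by (simp only:)
  moreover have "T \<in> borel_measurable \<mu>"
    using assms(2) borel_probD[OF \<mu>] measurable_cong_sets by blast
  ultimately show ?thesis by (rule AE_distrD[rotated])
qed

lemma measurable_funpow:
  "T \<in> measurable M M \<Longrightarrow> T ^^ n \<in> measurable M M"
  by (induction n) (auto intro: measurable_comp)

lemma invariant_map_funpow:
  assumes "invariant_map T \<mu>" "T \<in> borel_measurable borel"
  shows "invariant_map (T ^^ n) \<mu>"
proof (induction n)
  case 0
  then show ?case using assms(1) by (simp add: invariant_map_def)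
next
  case (Suc n)
  have "emeasure \<mu> ((T ^^ n) -` (T -` B)) = emeasure \<mu> B" if "B \<in> sets borel" for B
    using Suc assms that measurable_sets[OF assms(2) that] by (simp add: invariant_map_def)
  moreover have "(T ^^ Suc n) -` B = (T ^^ n) -` (T -` B)" for B
    by (simp only: funpow.simps vimage_comp)
  ultimately show ?case using assms(1) unfolding invariant_map_def by metis
qed

lemma invariant_map_AE_contraction:
  fixes V :: "'a::topological_space \<Rightarrow> real"
  assumes inv: "invariant_map T \<mu>" and T: "T \<in> borel_measurable borel"
    and V: "V \<in> borel_measurable borel" and \<rho>: "\<rho> > 1"
    and contr: "AE x in \<mu>. \<rho> * V (T x) \<le> V x"
  shows "AE x in \<mu>. V x \<le> 0"
proof -
  have \<mu>: "borel_prob \<mu>" using inv by (simp add: invariant_map_def)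
  note b = borel_probD[OF \<mu>]
  interpret prob_space \<mu> by (rule b)
  have sets: "{x. V x > r} \<in> sets borel" for r
    using V borel_measurable_iff_greater[of V borel] by simp
  have step: "measure \<mu> {x. V x > r} \<le> measure \<mu> {x. V x > \<rho> * r}" for r
  proof -
    have "emeasure \<mu> {x. V x > r} = emeasure \<mu> (T -` {x. V x > r})"
      using inv sets[of r] unfolding invariant_map_def by metis
    also have "\<dots> \<le> emeasure \<mu> {x. V x > \<rho> * r}"
    proof (rule emeasure_mono_AE)
      show "AE x in \<mu>. x \<in> T -` {x. V x > r} \<longrightarrow> x \<in> {x. V x > \<rho> * r}"
        using contr
      proof eventually_elim
        fix x assume "\<rho> * V (T x) \<le> V x"
        moreover have "\<rho> * r < \<rho> * V (T x)" if "r < V (T x)" using \<rho> that by simp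
        ultimately show "x \<in> T -` {x. V x > r} \<longrightarrow> x \<in> {x. V x > \<rho> * r}" by fastforce
      qed
    qed (use sets b in auto)
    finally show ?thesis by (simp add: emeasure_eq_measure)
  qed
  have null: "measure \<mu> {x. V x > r} = 0" if "r > 0" for r
  proof -
    have iter: "measure \<mu> {x. V x > r} \<le> measure \<mu> {x. V x > \<rho> ^ n * r}" for n
    proof (induction n)
      case (Suc n)
      then show ?case using step[of "\<rho> ^ n * r"] by (simp add: mult.assoc)
    qed simp
    have "(\<lambda>n. measure \<mu> {x. V x > \<rho> ^ n * r}) \<longlonglongrightarrow> measure \<mu> (\<Inter>n. {x. V x > \<rho> ^ n * r})"
    proof (rule finite_Lim_measure_decseq)
      show "decseq (\<lambda>n. {x. V x > \<rho> ^ n * r})"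
      proof (rule decseq_SucI, safe)
        fix n x assume "\<rho> ^ Suc n * r < V x"
        moreover have "\<rho> ^ n * r \<le> \<rho> ^ Suc n * r"
          using \<rho> that by (intro mult_right_mono power_increasing) auto
        ultimately show "\<rho> ^ n * r < V x" by linarith
      qed
    qed (use sets b in auto)
    moreover have "(\<Inter>n. {x. V x > \<rho> ^ n * r}) = {}"
    proof -
      have "\<exists>n. V x \<le> \<rho> ^ n * r" for x
      proof -
        obtain n where "V x / r < \<rho> ^ n" using real_arch_pow[OF \<rho>] by blast
        then show ?thesis using that by (intro exI[of _ n]) (simp add: field_simps)
      qed
      then show ?thesis by (auto simp: set_eq_iff not_less)
    qed
    ultimately have "(\<lambda>n. measure \<mu> {x. V x > \<rho> ^ n * r}) \<longlonglongrightarrow> 0" by simp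
    then have "measure \<mu> {x. V x > r} \<le> 0"
      by (rule LIMSEQ_le_const) (use iter in auto)
    then show ?thesis by (simp add: measure_le_0_iff)
  qed
  have "AE x in \<mu>. \<forall>n. V x \<le> 1 / real (Suc n)"
    unfolding AE_all_countable
  proof
    fix n
    show "AE x in \<mu>. V x \<le> 1 / real (Suc n)"
      by (rule AE_I[where N="{x. V x > 1 / real (Suc n)}"])
        (use null[of "1 / real (Suc n)"] sets b in \<open>auto simp: emeasure_eq_measure\<close>)
  qed
  then show ?thesis
  proof eventually_elim
    fix x assume le: "\<forall>n. V x \<le> 1 / real (Suc n)"
    show "V x \<le> 0"
    proof (rule ccontr)
      assume "\<not> V x \<le> 0"
      then obtain n where "inverse (real (Suc n)) < V x"
        using reals_Archimedean[of "V x"] by auto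
      then show False using le[rule_format, of n] by (simp add: divide_inverse)
    qed
  qed
qed

lemma weak_conv_AE_zero:
  fixes M :: "nat \<Rightarrow> 'a::topological_space measure" and d :: "'a \<Rightarrow> real"
  assumes conv: "weak_conv M M0" and M: "\<And>n. borel_prob (M n)" and M0: "borel_prob M0"
    and d: "continuous_on UNIV d" "\<And>x. 0 \<le> d x"
    and le: "\<And>n. AE x in M n. d x \<le> e n" and e: "e \<longlonglongrightarrow> 0"
  shows "AE x in M0. d x = 0"
proof -
  define f where "f x = min 1 (d x)" for x
  have cf: "continuous_on UNIV f" unfolding f_def by (intro continuous_intros d)
  have f: "0 \<le> f x" "f x \<le> 1" for x using d(2) by (auto simp: f_def)
  have bf: "bounded (range f)" using f by (auto simp: bounded_iff intro!: exI[of _ 1])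
  have f_meas: "f \<in> borel_measurable borel" by (rule borel_measurable_continuous_onI[OF cf])
  have int: "integrable \<nu> f" if "borel_prob \<nu>" for \<nu>
  proof -
    interpret prob_space \<nu> by (rule borel_probD[OF that])
    show ?thesis
      by (rule integrable_const_bound[where B=1])
        (use f f_meas borel_probD[OF that] measurable_cong_sets[of \<nu> borel borel borel] in auto)
  qed
  have "integral\<^sup>L (M n) f \<le> e n" for n
  proof -
    interpret prob_space "M n" by (rule borel_probD[OF M])
    have "integral\<^sup>L (M n) f \<le> integral\<^sup>L (M n) (\<lambda>_. e n)"
      by (rule integral_mono_AE[OF int[OF M]])
        (use le[of n] in \<open>auto elim!: eventually_mono simp: f_def\<close>)
    then show ?thesis by (simp add: prob_space)
  qed
  moreover have "(\<lambda>n. integral\<^sup>L (M n) f) \<longlonglongrightarrow> integral\<^sup>L M0 f"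
    using conv cf bf unfolding weak_conv_def by blast
  ultimately have "integral\<^sup>L M0 f \<le> 0" using LIMSEQ_le[OF _ e] by blast
  moreover have "integral\<^sup>L M0 f \<ge> 0" by (rule integral_nonneg_AE) (simp add: f)
  ultimately have "AE x in M0. f x = 0"
    using integral_nonneg_eq_0_iff_AE[OF int[OF M0]] f by auto
  then show ?thesis
  proof eventually_elim
    fix x assume "f x = 0"
    then show "d x = 0" by (simp add: f_def min_def split: if_splits)
  qed
qed

section \<open>Flows of dissipative differential equations\<close>

lemma ode_gronwall:
  fixes x y :: "real \<Rightarrow> 'z::real_inner"
  assumes t: "0 \<le> t"
    and x: "\<And>s. 0 \<le> s \<Longrightarrow> (x has_vector_derivative b (x s)) (at s within {0..})"
    and y: "\<And>s. 0 \<le> s \<Longrightarrow> (y has_vector_derivative b (y s)) (at s within {0..})"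
    and K: "\<And>s. s \<in> {0..t} \<Longrightarrow> x s \<in> K" "\<And>s. s \<in> {0..t} \<Longrightarrow> y s \<in> K"
    and L: "L-lipschitz_on K b"
  shows "norm (x t - y t) \<le> exp (L * t) * norm (x 0 - y 0)"
proof -
  define w where "w s = x s - y s" for s
  define h where "h s = exp (- (2 * L * s)) * (w s \<bullet> w s)" for s
  define h' where "h' s = exp (- (2 * L * s)) *
    (2 * (w s \<bullet> (b (x s) - b (y s))) - 2 * L * (w s \<bullet> w s))" for s
  have der: "(h has_derivative (\<lambda>r. r * h' s)) (at s within {0..t})" if "0 \<le> s" "s \<le> t" for s
  proof -
    have w: "(w has_derivative (\<lambda>r. r *\<^sub>R (b (x s) - b (y s)))) (at s within {0..t})"
      using has_vector_derivative_diff[OF x[OF that(1)] y[OF that(1)]] unfolding w_def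
      by (auto simp: has_vector_derivative_def intro: has_derivative_subset)
    show ?thesis unfolding h_def h'_def
      by (auto intro!: derivative_eq_intros w simp: algebra_simps inner_commute)
  qed
  have h'_le: "h' s \<le> 0" if "s \<in> {0..t}" for s
  proof -
    have "w s \<bullet> (b (x s) - b (y s)) \<le> norm (w s) * norm (b (x s) - b (y s))"
      by (rule norm_cauchy_schwarz)
    also have "\<dots> \<le> norm (w s) * (L * norm (w s))"
      using lipschitz_onD[OF L K(1)[OF that] K(2)[OF that]]
      by (intro mult_left_mono) (auto simp: dist_norm w_def)
    also have "\<dots> = L * (w s \<bullet> w s)"
      by (simp add: dot_square_norm power2_eq_square)
    finally show ?thesis by (simp add: h'_def mult_nonneg_nonpos)
  qed
  obtain s where s: "s \<in> {0..t}" "h t - h 0 = (t - 0) * h' s"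
    using mvt_very_simple[OF t der] by blast
  have "h t \<le> h 0" using s(2) mult_nonneg_nonpos[OF t h'_le[OF s(1)]] by simp
  then have "(norm (w t))\<^sup>2 \<le> exp (2 * L * t) * (norm (w 0))\<^sup>2"
    by (simp add: h_def dot_square_norm exp_minus field_simps)
  also have "\<dots> = (exp (L * t) * norm (w 0))\<^sup>2"
    by (simp add: power_mult_distrib exp_double[symmetric] mult.assoc)
  finally show ?thesis unfolding w_def by (rule power2_le_imp_le) simp
qed

lemma ode_norm_bound:
  fixes x :: "real \<Rightarrow> 'z::real_inner"
  assumes t: "0 \<le> t"
    and x: "\<And>s. 0 \<le> s \<Longrightarrow> (x has_vector_derivative b (x s)) (at s within {0..})"
    and C: "\<And>z. z \<bullet> b z \<le> C"
  shows "(norm (x t))\<^sup>2 \<le> (norm (x 0))\<^sup>2 + 2 * C * t"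
proof -
  define h where "h s = x s \<bullet> x s - 2 * C * s" for s
  have der: "(h has_derivative (\<lambda>r. r * (2 * (x s \<bullet> b (x s)) - 2 * C))) (at s within {0..t})"
    if "0 \<le> s" "s \<le> t" for s
  proof -
    have w: "(x has_derivative (\<lambda>r. r *\<^sub>R b (x s))) (at s within {0..t})"
      using x[OF that(1)] by (auto simp: has_vector_derivative_def intro: has_derivative_subset)
    show ?thesis unfolding h_def
      by (auto intro!: derivative_eq_intros w simp: algebra_simps inner_commute)
  qed
  obtain s where "h t - h 0 = (t - 0) * (2 * (x s \<bullet> b (x s)) - 2 * C)"
    using mvt_very_simple[OF t der] by blast
  moreover have "(t - 0) * (2 * (x s \<bullet> b (x s)) - 2 * C) \<le> 0"
    using t C[of "x s"] by (intro mult_nonneg_nonpos) auto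
  ultimately have "h t \<le> h 0" by linarith
  then show ?thesis by (simp add: h_def dot_square_norm)
qed

lemma ode_lipschitz_time:
  fixes x :: "real \<Rightarrow> 'z::real_normed_vector"
  assumes x: "\<And>s. 0 \<le> s \<Longrightarrow> (x has_vector_derivative b (x s)) (at s within {0..})"
    and G: "\<And>s. s \<in> {0..t} \<Longrightarrow> norm (b (x s)) \<le> G"
    and rs: "r \<in> {0..t}" "s \<in> {0..t}"
  shows "norm (x r - x s) \<le> G * \<bar>r - s\<bar>"
proof -
  have "norm (x r - x s) \<le> G * norm (r - s)"
  proof (rule differentiable_bound[where S="{0..t}" and f'="\<lambda>s r. r *\<^sub>R b (x s)"])
    show "(x has_derivative (\<lambda>r. r *\<^sub>R b (x s))) (at s within {0..t})" if "s \<in> {0..t}" for s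
      using x[of s] that by (auto simp: has_vector_derivative_def intro: has_derivative_subset)
    show "onorm (\<lambda>r. r *\<^sub>R b (x s)) \<le> G" if "s \<in> {0..t}" for s
      using G[OF that] by (intro onorm_le) (auto simp: mult.commute[of G] intro: mult_left_mono)
  qed (use rs in auto)
  then show ?thesis by simp
qed

lemma ode_euler_step:
  fixes x :: "real \<Rightarrow> 'z::real_normed_vector"
  assumes x: "\<And>s. 0 \<le> s \<Longrightarrow> (x has_vector_derivative b (x s)) (at s within {0..})"
    and K: "\<And>s. s \<in> {0..t} \<Longrightarrow> x s \<in> K"
    and L: "L-lipschitz_on K b" and G: "\<And>z. z \<in> K \<Longrightarrow> norm (b z) \<le> G"
    and sk: "0 \<le> s" "0 \<le> k" "s + k \<le> t"
  shows "norm (x (s + k) - x s - k *\<^sub>R b (x s)) \<le> L * G * k\<^sup>2"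
proof -
  have "norm (x (s + k) - x s - ((s + k) - s) *\<^sub>R b (x s)) \<le> norm ((s + k) - s) * (L * G * k)"
  proof (rule vector_differentiable_bound_linearization[where S="{s..s+k}"])
    show "(x has_vector_derivative b (x r)) (at r within {s..s+k})" if "r \<in> {s..s+k}" for r
      using x[of r] that sk by (auto intro: has_vector_derivative_within_subset)
    show "norm (b (x r) - b (x s)) \<le> L * G * k" if "r \<in> {s..s+k}" for r
    proof -
      have "r \<in> {0..t}" "s \<in> {0..t}" using that sk by auto
      then have "norm (b (x r) - b (x s)) \<le> L * norm (x r - x s)"
        using lipschitz_onD[OF L K K, of r s] by (simp add: dist_norm)
      also have "\<dots> \<le> L * (G * \<bar>r - s\<bar>)"
        using \<open>r \<in> {0..t}\<close> \<open>s \<in> {0..t}\<close> G K lipschitz_on_nonneg[OF L]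
        by (intro mult_left_mono ode_lipschitz_time[where x=x and b=b and t=t] x) auto
      also have "\<dots> \<le> L * (G * k)"
        using that sk lipschitz_on_nonneg[OF L] order_trans[OF norm_ge_zero G[OF K[OF \<open>s \<in> {0..t}\<close>]]]
        by (intro mult_left_mono) auto
      finally show ?thesis by (simp add: mult.assoc)
    qed
  qed (use sk in \<open>auto simp: closed_segment_eq_real_ivl\<close>)
  then show ?thesis using sk by (simp add: power2_eq_square mult_ac)
qed

lemma norm_add_diff_bound:
  fixes u v w z :: "'z::real_normed_vector"
  assumes "norm u \<le> a" "norm v \<le> b" "norm w \<le> c" "norm z \<le> d"
  shows "norm (u - v + w + z) \<le> a + b + c + d"
  using assms norm_triangle_ineq[of "u - v + w" z] norm_triangle_ineq[of "u - v" w]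
    norm_triangle_ineq4[of u v] by linarith

lemma perturbed_euler_convergence:
  fixes x :: "real \<Rightarrow> 'z::real_normed_vector" and y :: "nat \<Rightarrow> 'z"
  assumes x: "\<And>s. 0 \<le> s \<Longrightarrow> (x has_vector_derivative b (x s)) (at s within {0..})"
    and K: "\<And>s. s \<in> {0..t} \<Longrightarrow> x s \<in> K" "\<And>i. y i \<in> K"
    and L: "L-lipschitz_on K b" and G: "\<And>z. z \<in> K \<Longrightarrow> norm (b z) \<le> G"
    and y: "y 0 = x 0" "\<And>i. norm (y (Suc i) - y i - k *\<^sub>R b (y i)) \<le> D * k\<^sup>2"
    and k: "0 < k" and t: "0 \<le> t"
  shows "norm (y (nat \<lfloor>t / k\<rfloor>) - x t) \<le> (exp (L * t) * t * (D + L * G) + G) * k"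
proof -
  have L0: "0 \<le> L" by (rule lipschitz_on_nonneg[OF L])
  have G0: "0 \<le> G" using order_trans[OF norm_ge_zero G[OF K(2)]] .
  have "0 \<le> D * k\<^sup>2" using order_trans[OF norm_ge_zero y(2)] .
  then have D0: "0 \<le> D" using k by (simp add: zero_le_mult_iff)
  define D' where "D' = D + L * G"
  have D'0: "0 \<le> D'" using D0 L0 G0 by (simp add: D'_def)
  have err: "norm (y n - x (n * k)) \<le> (1 + L * k) ^ n * n * D' * k\<^sup>2" if "n * k \<le> t" for n
    using that
  proof (induction n)
    case 0
    then show ?case using y(1) by simp
  next
    case (Suc n)
    define e where "e = norm (y n - x (n * k))"
    have nk: "n * k + k \<le> t" "n * k \<le> t" "0 \<le> n * k"
      using Suc.prems k by (auto simp: algebra_simps)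
    have IH: "e \<le> (1 + L * k) ^ n * n * D' * k\<^sup>2" using Suc.IH nk by (simp add: e_def)
    have "y (Suc n) - x (n * k + k) = (y (Suc n) - y n - k *\<^sub>R b (y n))
        - (x (n * k + k) - x (n * k) - k *\<^sub>R b (x (n * k)))
        + (y n - x (n * k)) + k *\<^sub>R (b (y n) - b (x (n * k)))"
      by (simp add: algebra_simps)
    also have "norm \<dots> \<le> D * k\<^sup>2 + L * G * k\<^sup>2 + e + k * (L * e)"
    proof (rule norm_add_diff_bound)
      show "norm (y (Suc n) - y n - k *\<^sub>R b (y n)) \<le> D * k\<^sup>2" by (rule y)
      show "norm (x (n * k + k) - x (n * k) - k *\<^sub>R b (x (n * k))) \<le> L * G * k\<^sup>2"
        using nk k by (intro ode_euler_step[OF x K(1) L G]) auto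
      show "norm (k *\<^sub>R (b (y n) - b (x (n * k)))) \<le> k * (L * e)"
        using lipschitz_onD[OF L K(2) K(1), of "n * k" n] nk k
        by (auto simp: e_def dist_norm)
    qed (simp add: e_def)
    also have "\<dots> = (1 + L * k) * e + D' * k\<^sup>2" by (simp add: D'_def algebra_simps)
    also have "\<dots> \<le> (1 + L * k) * ((1 + L * k) ^ n * n * D' * k\<^sup>2) + (1 + L * k) ^ Suc n * (D' * k\<^sup>2)"
    proof (rule add_mono)
      show "(1 + L * k) * e \<le> (1 + L * k) * ((1 + L * k) ^ n * n * D' * k\<^sup>2)"
        using IH L0 k by (intro mult_left_mono) auto
      have "1 \<le> (1 + L * k) ^ Suc n" using L0 k by (intro one_le_power) auto
      then show "D' * k\<^sup>2 \<le> (1 + L * k) ^ Suc n * (D' * k\<^sup>2)"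
        using D'0 mult_right_mono[of 1 "(1 + L * k) ^ Suc n" "D' * k\<^sup>2"] by simp
    qed
    also have "\<dots> = (1 + L * k) ^ Suc n * real (Suc n) * D' * k\<^sup>2"
      by (simp add: algebra_simps)
    finally show ?case by (simp add: algebra_simps)
  qed
  define n where "n = nat \<lfloor>t / k\<rfloor>"
  have tk: "0 \<le> t / k" using t k by simp
  have n: "real n \<le> t / k" "t / k < real n + 1" using tk unfolding n_def by linarith+
  have nk: "n * k \<le> t" "t - n * k \<le> k" using n k by (auto simp: field_simps)
  have "(1 + L * k) ^ n \<le> exp (L * k) ^ n"
    using L0 k by (intro power_mono) auto
  also have "\<dots> = exp (L * (n * k))" by (simp add: exp_of_nat_mult[symmetric] mult_ac)
  also have "\<dots> \<le> exp (L * t)" using nk L0 by (simp add: mult_left_mono)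
  finally have pow: "(1 + L * k) ^ n \<le> exp (L * t)" .
  have "norm (y n - x (n * k)) \<le> (1 + L * k) ^ n * ((n * k) * (D' * k))"
    using err[OF nk(1)] by (simp add: power2_eq_square mult_ac)
  also have "\<dots> \<le> exp (L * t) * (t * (D' * k))"
    using pow nk(1) D'0 k by (intro mult_mono mult_right_mono) auto
  finally have 1: "norm (y n - x (n * k)) \<le> exp (L * t) * t * D' * k" by (simp add: mult.assoc)
  have "norm (x (n * k) - x t) \<le> G * \<bar>n * k - t\<bar>"
    using nk t k G K by (intro ode_lipschitz_time[where b=b and t=t] x) auto
  also have "\<dots> \<le> G * k" using nk G0 by (intro mult_left_mono) auto
  finally have "norm (y n - x (n * k)) + norm (x (n * k) - x t) \<le> exp (L * t) * t * D' * k + G * k"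
    using 1 by simp
  then show ?thesis
    using norm_triangle_ineq[of "y n - x (n * k)" "x (n * k) - x t"]
    by (simp add: n_def D'_def algebra_simps)
qed

lemma flow_continuous:
  fixes \<Phi> :: "real \<Rightarrow> 'z::euclidean_space \<Rightarrow> 'z"
  assumes init: "\<And>z. \<Phi> 0 z = z"
    and ode: "\<And>z t. 0 \<le> t \<Longrightarrow> ((\<lambda>s. \<Phi> s z) has_vector_derivative b (\<Phi> t z)) (at t within {0..})"
    and C: "\<And>z. z \<bullet> b z \<le> C"
    and b: "\<And>R. \<exists>L. L-lipschitz_on (cball 0 R) b" and t: "0 \<le> t"
  shows "continuous_on UNIV (\<Phi> t)"
proof -
  have C0: "0 \<le> C" using C[of 0] by simp
  have cont: "continuous_on (ball 0 R) (\<Phi> t)" for R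
  proof -
    define R' where "R' = sqrt (R\<^sup>2 + 2 * C * t)"
    obtain L where L: "L-lipschitz_on (cball 0 R') b" using b by blast
    have bound: "\<Phi> s z \<in> cball 0 R'" if "z \<in> ball 0 R" "s \<in> {0..t}" for s z
    proof -
      have "(norm (\<Phi> s z))\<^sup>2 \<le> (norm z)\<^sup>2 + 2 * C * s"
        using ode_norm_bound[of s "\<lambda>s. \<Phi> s z" b C] ode C that init by simp
      also have "\<dots> \<le> R\<^sup>2 + 2 * C * t"
        using that C0 by (intro add_mono power_mono mult_left_mono) auto
      finally show ?thesis unfolding R'_def by (simp add: real_le_rsqrt)
    qed
    have "norm (\<Phi> t z - \<Phi> t z') \<le> exp (L * t) * norm (z - z')"
      if "z \<in> ball 0 R" "z' \<in> ball 0 R" for z z'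
      using ode_gronwall[of t "\<lambda>s. \<Phi> s z" b "\<lambda>s. \<Phi> s z'" "cball 0 R'" L] ode L bound that t init by simp
    then have "(exp (L * t))-lipschitz_on (ball 0 R) (\<Phi> t)"
      by (intro lipschitz_onI) (auto simp: dist_norm)
    then show ?thesis by (rule lipschitz_on_continuous_on)
  qed
  have "continuous (at z) (\<Phi> t)" for z
    using cont[of "norm z + 1"] continuous_on_eq_continuous_at[of "ball 0 (norm z + 1)" "\<Phi> t"] by auto
  then show ?thesis by (simp add: continuous_on_eq_continuous_at)
qed

lemma locally_lipschitz_imp_lipschitz_compact:
  assumes "locally_lipschitz f" "compact K"
  obtains L where "L-lipschitz_on K f"
proof -
  have "local_lipschitz {0::real} K (\<lambda>_. f)"
  proof (rule local_lipschitzI)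
    fix t x assume "x \<in> K"
    obtain e L where e: "e > 0" "\<forall>y\<in>ball x e. \<forall>z\<in>ball x e. dist (f y) (f z) \<le> L * dist y z"
      using assms(1) unfolding locally_lipschitz_def by meson
    have "\<bar>L\<bar>-lipschitz_on (cball x (e/2) \<inter> K) f"
    proof (rule lipschitz_onI)
      fix y z assume "y \<in> cball x (e/2) \<inter> K" "z \<in> cball x (e/2) \<inter> K"
      then have "dist (f y) (f z) \<le> L * dist y z" using e by auto
      also have "\<dots> \<le> \<bar>L\<bar> * dist y z" by (intro mult_right_mono) auto
      finally show "dist (f y) (f z) \<le> \<bar>L\<bar> * dist y z" .
    qed simp
    then show "\<exists>u>0. \<exists>L. \<forall>t\<in>cball t u \<inter> {0}. L-lipschitz_on (cball x u \<inter> K) f"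
      using e(1) by (intro exI[of _ "e/2"]) auto
  qed
  then show ?thesis
    using local_lipschitz_compact_implies_lipschitz[OF _ assms(2), of "{0::real}" "\<lambda>_. f"] that by auto
qed

lemma weak_limit_invariant_semigroup:
  fixes M :: "nat \<Rightarrow> 'x::topological_space measure" and Y :: "'x \<Rightarrow> 'z::euclidean_space"
    and \<Phi> :: "real \<Rightarrow> 'z \<Rightarrow> 'z"
  assumes init: "\<And>z. \<Phi> 0 z = z"
    and ode: "\<And>z t. 0 \<le> t \<Longrightarrow> ((\<lambda>s. \<Phi> s z) has_vector_derivative b (\<Phi> t z)) (at t within {0..})"
    and C: "\<And>z. z \<bullet> b z \<le> C"
    and b: "\<And>R. \<exists>L. L-lipschitz_on (cball 0 R) b"
    and Y: "continuous_on UNIV Y"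
    and conv: "weak_conv M M0" and M0: "borel_prob M0"
    and inv: "\<And>n. invariant_map (T n) (M n)" and T: "\<And>n. T n \<in> borel_measurable borel"
    and bound: "\<And>n. AE x in M n. norm (Y x) \<le> R"
    and consistent: "\<And>n. AE x in M n. norm (Y (T n x) - Y x - k n *\<^sub>R b (Y x)) \<le> D * (k n)\<^sup>2"
    and k: "\<And>n. 0 < k n" "k \<longlonglongrightarrow> 0"
  shows "invariant_semigroup \<Phi> (distr M0 borel Y)"
  unfolding invariant_semigroup_def
proof (intro allI impI)
  fix t :: real assume t: "0 \<le> t"
  have M: "borel_prob (M n)" for n using inv by (simp add: invariant_map_def)
  have meas: "f \<in> borel_measurable \<nu>" if "borel_prob \<nu>" "f \<in> borel_measurable borel"
    for f :: "'x \<Rightarrow> 'b::topological_space" and \<nu>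
    using that borel_probD[OF that(1)] measurable_cong_sets[of \<nu> borel borel borel] by auto
  have Y_meas: "Y \<in> borel_measurable borel" by (rule borel_measurable_continuous_onI[OF Y])
  have \<Phi>_cont: "continuous_on UNIV (\<Phi> t)" by (rule flow_continuous[OF init ode C b t])
  have \<Phi>_meas: "\<Phi> t \<in> borel_measurable borel" by (rule borel_measurable_continuous_onI[OF \<Phi>_cont])
  have distr_Y: "borel_prob (distr M0 borel Y)" by (rule borel_prob_distr[OF M0 Y_meas])
  have C0: "0 \<le> C" using C[of 0] by simp
  define R' where "R' = sqrt (R\<^sup>2 + 2 * C * t)"
  have flow_bound: "\<Phi> s z \<in> cball 0 R'" if "norm z \<le> R" "s \<in> {0..t}" for s z
  proof -
    have "(norm (\<Phi> s z))\<^sup>2 \<le> (norm z)\<^sup>2 + 2 * C * s"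
      using ode_norm_bound[of s "\<lambda>s. \<Phi> s z" b C] ode C that init by simp
    also have "\<dots> \<le> R\<^sup>2 + 2 * C * t"
      using that C0 by (intro add_mono power_mono mult_left_mono) auto
    finally show ?thesis unfolding R'_def by (simp add: real_le_rsqrt)
  qed
  obtain L where L: "L-lipschitz_on (cball 0 R') b" using b by blast
  have "bounded (b ` cball 0 R')"
    by (intro compact_imp_bounded compact_continuous_image lipschitz_on_continuous_on[OF L]) simp
  then obtain G where G: "\<And>z. z \<in> cball 0 R' \<Longrightarrow> norm (b z) \<le> G"
    unfolding bounded_iff by (metis imageI)
  define E where "E = exp (L * t) * t * (D + L * G) + G"
  define m where "m n = nat \<lfloor>t / k n\<rfloor>" for n
  have close: "AE x in M n. Y ((T n ^^ m n) x) \<in> cball 0 R' \<and> \<Phi> t (Y x) \<in> cball 0 R' \<and>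
      norm (Y ((T n ^^ m n) x) - \<Phi> t (Y x)) \<le> E * k n" for n
  proof -
    have "AE x in M n. norm (Y ((T n ^^ i) x)) \<le> R \<and>
        norm (Y ((T n ^^ Suc i) x) - Y ((T n ^^ i) x) - k n *\<^sub>R b (Y ((T n ^^ i) x))) \<le> D * (k n)\<^sup>2" for i
      using invariant_map_AE_compose[OF invariant_map_funpow[OF inv[of n] T] measurable_funpow[OF T]
          AE_conjI[OF bound consistent], of i] by simp
    then have "AE x in M n. \<forall>i. norm (Y ((T n ^^ i) x)) \<le> R \<and>
        norm (Y ((T n ^^ Suc i) x) - Y ((T n ^^ i) x) - k n *\<^sub>R b (Y ((T n ^^ i) x))) \<le> D * (k n)\<^sup>2"
      unfolding AE_all_countable by blast
    then show ?thesis
    proof eventually_elim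
      fix x
      assume x: "\<forall>i. norm (Y ((T n ^^ i) x)) \<le> R \<and>
        norm (Y ((T n ^^ Suc i) x) - Y ((T n ^^ i) x) - k n *\<^sub>R b (Y ((T n ^^ i) x))) \<le> D * (k n)\<^sup>2"
      have Yx: "norm (Y x) \<le> R" using x[rule_format, of 0] by simp
      have in_ball: "Y ((T n ^^ i) x) \<in> cball 0 R'" for i
        using flow_bound[of "Y ((T n ^^ i) x)" 0] x t init by simp
      have "norm (Y ((T n ^^ m n) x) - \<Phi> t (Y x)) \<le> E * k n"
        unfolding E_def m_def
        by (rule perturbed_euler_convergence[where b=b and K="cball 0 R'" and x="\<lambda>s. \<Phi> s (Y x)"
              and y="\<lambda>i. Y ((T n ^^ i) x)", OF ode flow_bound[OF Yx] in_ball L G])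
          (use x k t init in auto)
      then show "Y ((T n ^^ m n) x) \<in> cball 0 R' \<and> \<Phi> t (Y x) \<in> cball 0 R' \<and>
          norm (Y ((T n ^^ m n) x) - \<Phi> t (Y x)) \<le> E * k n"
        using in_ball flow_bound[OF Yx, of t] t by simp
    qed
  qed
  have "distr (distr M0 borel Y) borel (\<Phi> t) = distr M0 borel Y"
  proof (rule borel_prob_eqI)
    show "borel_prob (distr (distr M0 borel Y) borel (\<Phi> t))"
      by (rule borel_prob_distr[OF distr_Y \<Phi>_meas])
    show "borel_prob (distr M0 borel Y)" by (rule distr_Y)
    fix f :: "'z \<Rightarrow> real" assume f: "continuous_on UNIV f" "bounded (range f)"
    obtain B where B: "\<And>z. norm (f z) \<le> B" using f(2) by (auto simp: bounded_iff)
    have f_meas: "f \<in> borel_measurable borel" by (rule borel_measurable_continuous_onI[OF f(1)])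
    define f1 where "f1 x = f (Y x)" for x
    define f2 where "f2 x = f (\<Phi> t (Y x))" for x
    have cont1: "continuous_on UNIV f1" unfolding f1_def
      by (rule continuous_on_compose2[OF f(1) Y]) simp
    have cont2: "continuous_on UNIV f2" unfolding f2_def
      by (intro continuous_on_compose2[OF f(1)] continuous_on_compose2[OF \<Phi>_cont Y]) simp_all
    have f1_meas: "f1 \<in> borel_measurable borel" by (rule borel_measurable_continuous_onI[OF cont1])
    have f2_meas: "f2 \<in> borel_measurable borel" by (rule borel_measurable_continuous_onI[OF cont2])
    have bdd: "bounded (range f1)" "bounded (range f2)"
      using B by (auto simp: bounded_iff f1_def f2_def)
    have lim: "(\<lambda>n. integral\<^sup>L (M n) f1 - integral\<^sup>L (M n) f2) \<longlonglongrightarrow> integral\<^sup>L M0 f1 - integral\<^sup>L M0 f2"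
      by (intro tendsto_diff) (use conv cont1 cont2 bdd in \<open>auto simp: weak_conv_def\<close>)
    have lim0: "(\<lambda>n. integral\<^sup>L (M n) f1 - integral\<^sup>L (M n) f2) \<longlonglongrightarrow> 0"
    proof (rule LIMSEQ_I)
      fix \<epsilon> :: real assume "\<epsilon> > 0"
      have "uniformly_continuous_on (cball 0 R') f"
        by (rule compact_uniformly_continuous[OF continuous_on_subset[OF f(1)]]) auto
      then obtain d where d: "d > 0" "\<And>z z'. z \<in> cball 0 R' \<Longrightarrow> z' \<in> cball 0 R' \<Longrightarrow>
          dist z' z < d \<Longrightarrow> dist (f z') (f z) < \<epsilon> / 2"
        using \<open>\<epsilon> > 0\<close> unfolding uniformly_continuous_on_def by (meson half_gt_zero)
      have "(\<lambda>n. E * k n) \<longlonglongrightarrow> 0" using tendsto_mult_left[OF k(2), of E] by simp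
      then have "\<forall>\<^sub>F n in sequentially. E * k n < d" using order_tendstoD(2) d(1) by blast
      then obtain n0 where n0: "\<And>n. n \<ge> n0 \<Longrightarrow> E * k n < d"
        by (auto simp: eventually_sequentially)
      have "norm (integral\<^sup>L (M n) f1 - integral\<^sup>L (M n) f2 - 0) < \<epsilon>" if "n \<ge> n0" for n
      proof -
        interpret prob_space "M n" by (rule borel_probD[OF M])
        define f3 where "f3 x = f1 ((T n ^^ m n) x)" for x
        have Tm_meas: "T n ^^ m n \<in> borel_measurable borel" by (rule measurable_funpow[OF T])
        have f3_meas: "f3 \<in> borel_measurable borel"
          using measurable_comp[OF Tm_meas f1_meas] by (simp add: f3_def[abs_def] comp_def)
        have eq: "integral\<^sup>L (M n) f1 = integral\<^sup>L (M n) f3"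
        proof -
          have "distr (M n) borel (T n ^^ m n) = M n"
            using invariant_map_iff_distr[OF M Tm_meas] invariant_map_funpow[OF inv T] by blast
          then show ?thesis
            using integral_distr[OF meas[OF M[of n] Tm_meas] f1_meas] by (simp add: f3_def[abs_def])
        qed
        have int: "integrable (M n) f3" "integrable (M n) f2"
          by (auto intro!: integrable_const_bound[where B=B] meas M f3_meas f2_meas
              simp: f1_def f2_def f3_def B[simplified])
        have "AE x in M n. \<bar>f3 x - f2 x\<bar> \<le> \<epsilon> / 2"
          using close[of n]
        proof eventually_elim
          fix x
          assume "Y ((T n ^^ m n) x) \<in> cball 0 R' \<and> \<Phi> t (Y x) \<in> cball 0 R' \<and>
              norm (Y ((T n ^^ m n) x) - \<Phi> t (Y x)) \<le> E * k n"
          then have "dist (f (Y ((T n ^^ m n) x))) (f (\<Phi> t (Y x))) < \<epsilon> / 2"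
            using n0[OF that] by (intro d(2)) (auto simp: dist_norm)
          then show "\<bar>f3 x - f2 x\<bar> \<le> \<epsilon> / 2"
            by (simp add: f1_def f2_def f3_def dist_real_def)
        qed
        then have "integral\<^sup>L (M n) (\<lambda>x. \<bar>f3 x - f2 x\<bar>) \<le> integral\<^sup>L (M n) (\<lambda>_. \<epsilon> / 2)"
          by (intro integral_mono_AE) (use int in auto)
        then have "integral\<^sup>L (M n) (\<lambda>x. \<bar>f3 x - f2 x\<bar>) \<le> \<epsilon> / 2" by (simp add: prob_space)
        moreover have "\<bar>integral\<^sup>L (M n) f3 - integral\<^sup>L (M n) f2\<bar> \<le> integral\<^sup>L (M n) (\<lambda>x. \<bar>f3 x - f2 x\<bar>)"
          using integral_abs_bound[of "M n" "\<lambda>x. f3 x - f2 x"] int by simp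
        ultimately show ?thesis using eq \<open>\<epsilon> > 0\<close> by simp
      qed
      then show "\<exists>no. \<forall>n\<ge>no. norm (integral\<^sup>L (M n) f1 - integral\<^sup>L (M n) f2 - 0) < \<epsilon>" by blast
    qed
    have "integral\<^sup>L M0 f1 = integral\<^sup>L M0 f2" using LIMSEQ_unique[OF lim lim0] by simp
    moreover have "integral\<^sup>L (distr M0 borel Y) f = integral\<^sup>L M0 f1"
      unfolding f1_def by (rule integral_distr[OF meas[OF M0 Y_meas] f_meas])
    moreover have "integral\<^sup>L (distr (distr M0 borel Y) borel (\<Phi> t)) f = integral\<^sup>L M0 f2"
    proof -
      have "(\<lambda>z. f (\<Phi> t z)) \<in> borel_measurable borel"
        using measurable_comp[OF \<Phi>_meas f_meas] by (simp add: comp_def)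
      moreover have "\<Phi> t \<in> borel_measurable (distr M0 borel Y)" using \<Phi>_meas by simp
      ultimately show ?thesis
        unfolding f2_def by (simp add: integral_distr f_meas meas[OF M0 Y_meas])
    qed
    ultimately show "integral\<^sup>L (distr (distr M0 borel Y) borel (\<Phi> t)) f = integral\<^sup>L (distr M0 borel Y) f"
      by simp
  qed
  then show "invariant_map (\<Phi> t) (distr M0 borel Y)"
    using invariant_map_iff_distr[OF distr_Y \<Phi>_meas] by simp
qed

section \<open>The BDF2 scheme\<close>

lemma bdf2_system_solution:
  fixes A :: "'a::euclidean_space \<Rightarrow> 'a" and \<gamma> a :: real
  assumes A: "linear A" and pos: "\<And>u. 0 \<le> A u \<bullet> u" and a: "0 < a" and \<gamma>: "0 \<le> \<gamma>"
  obtains R :: "'a \<Rightarrow> 'a" where "linear R"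
    "\<And>n. 0 < a + \<gamma> + n \<bullet> R n"
    "\<And>n g h u q. a *\<^sub>R u + A u + q *\<^sub>R n = g \<and> a * q + \<gamma> * q - n \<bullet> u = h \<longleftrightarrow>
      q = (h + n \<bullet> R g) / (a + \<gamma> + n \<bullet> R n) \<and> u = R (g - q *\<^sub>R n)"
proof -
  define B where "B u = a *\<^sub>R u + A u" for u
  have B: "linear B" unfolding B_def
    by (intro linear_compose_add A linear_compose_scale_right linear_ident)
  have "u = 0" if "B u = 0" for u
  proof -
    have "a * (u \<bullet> u) + A u \<bullet> u = B u \<bullet> u" by (simp add: B_def inner_add_left)
    then have "a * (u \<bullet> u) \<le> 0" using pos[of u] that by simp
    then have "u \<bullet> u \<le> 0" using a by (simp add: mult_le_0_iff)
    then show "u = 0" by (metis inner_gt_zero_iff not_le)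
  qed
  then have "inj B" using linear_injective_0[OF B] by blast
  then obtain R where R: "linear R" "\<And>x. R (B x) = x" "\<And>x. B (R x) = x"
    using linear_injective_isomorphism[OF B] by blast
  have Rpos: "0 < a + \<gamma> + n \<bullet> R n" for n
  proof -
    have "n \<bullet> R n = a * (R n \<bullet> R n) + A (R n) \<bullet> R n"
      using R(3)[of n] by (metis B_def inner_add_left inner_scaleR_left)
    then show ?thesis using pos[of "R n"] a \<gamma> inner_ge_zero[of "R n"]
      by (smt (verit) mult_nonneg_nonneg)
  qed
  have "a *\<^sub>R u + A u + q *\<^sub>R n = g \<and> a * q + \<gamma> * q - n \<bullet> u = h \<longleftrightarrow>
      q = (h + n \<bullet> R g) / (a + \<gamma> + n \<bullet> R n) \<and> u = R (g - q *\<^sub>R n)" for n g h u q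
  proof -
    have "a *\<^sub>R u + A u + q *\<^sub>R n = g \<longleftrightarrow> B u = g - q *\<^sub>R n"
      by (auto simp: B_def algebra_simps)
    also have "\<dots> \<longleftrightarrow> u = R (g - q *\<^sub>R n)" using R by metis
    finally have 1: "a *\<^sub>R u + A u + q *\<^sub>R n = g \<longleftrightarrow> u = R (g - q *\<^sub>R n)" .
    have "a * q + \<gamma> * q - n \<bullet> R (g - q *\<^sub>R n) = q * (a + \<gamma> + n \<bullet> R n) - n \<bullet> R g"
      by (simp add: linear_diff[OF R(1)] linear_scale[OF R(1)] inner_diff_right algebra_simps)
    then have "a * q + \<gamma> * q - n \<bullet> R (g - q *\<^sub>R n) = h \<longleftrightarrow> q = (h + n \<bullet> R g) / (a + \<gamma> + n \<bullet> R n)"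
      using Rpos[of n] by (auto simp: field_simps)
    then show ?thesis using 1 by (cases "u = R (g - q *\<^sub>R n)") auto
  qed
  then show ?thesis using that R(1) Rpos by blast
qed

lemma
  fixes A N :: "'a::euclidean_space \<Rightarrow> 'a"
  assumes A: "linear A" "\<And>u. 0 \<le> A u \<bullet> u" and k: "0 < k" and \<gamma>: "0 \<le> \<gamma>"
  shows bdf2_map_continuous: "continuous_on UNIV N \<Longrightarrow> continuous_on UNIV (bdf2_map A N F \<gamma> k)"
    and P1_bdf2_map: "P1 (bdf2_map A N F \<gamma> k x) = P2 x"
    and bdf2_map_eq:
      "3 *\<^sub>R P2 (bdf2_map A N F \<gamma> k x) - 4 *\<^sub>R P2 x + P1 x =
       (2 * k) *\<^sub>R (let w = fst (2 *\<^sub>R P2 x - P1 x); z = P2 (bdf2_map A N F \<gamma> k x)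
         in (F - A (fst z) - snd z *\<^sub>R N w, N w \<bullet> fst z - \<gamma> * snd z + \<gamma>))"
proof -
  have a: "0 < 3 / (2 * k)" using k by simp
  obtain R where R: "linear R" "\<And>n. 0 < 3 / (2 * k) + \<gamma> + n \<bullet> R n"
    "\<And>n g h u q. (3 / (2 * k)) *\<^sub>R u + A u + q *\<^sub>R n = g \<and> 3 / (2 * k) * q + \<gamma> * q - n \<bullet> u = h \<longleftrightarrow>
      q = (h + n \<bullet> R g) / (3 / (2 * k) + \<gamma> + n \<bullet> R n) \<and> u = R (g - q *\<^sub>R n)"
    using bdf2_system_solution[OF A a \<gamma>] by blast
  define n where "n x = N (2 *\<^sub>R snd (fst x) - fst (fst x))" for x :: "('a \<times> 'a) \<times> (real \<times> real)"
  define g where "g x = F + (1 / (2 * k)) *\<^sub>R (4 *\<^sub>R snd (fst x) - fst (fst x))"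
    for x :: "('a \<times> 'a) \<times> (real \<times> real)"
  define h where "h x = \<gamma> + (4 * snd (snd x) - fst (snd x)) / (2 * k)"
    for x :: "('a \<times> 'a) \<times> (real \<times> real)"
  define Q where "Q x = (h x + n x \<bullet> R (g x)) / (3 / (2 * k) + \<gamma> + n x \<bullet> R (n x))" for x
  define U where "U x = R (g x - Q x *\<^sub>R n x)" for x
  have system: "(1 / (2 * k)) *\<^sub>R (3 *\<^sub>R u2 - 4 *\<^sub>R u1 + u0) + A u2 + q2 *\<^sub>R N (2 *\<^sub>R u1 - u0) = F
      \<and> (3 * q2 - 4 * q1 + q0) / (2 * k) + \<gamma> * q2 - N (2 *\<^sub>R u1 - u0) \<bullet> u2 = \<gamma>
      \<longleftrightarrow> u2 = U ((u0, u1), (q0, q1)) \<and> q2 = Q ((u0, u1), (q0, q1))" for u0 u1 u2 q0 q1 q2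
  proof -
    let ?x = "((u0, u1), (q0, q1))"
    have "(1 / (2 * k)) *\<^sub>R (3 *\<^sub>R u2 - 4 *\<^sub>R u1 + u0) + A u2 + q2 *\<^sub>R N (2 *\<^sub>R u1 - u0) = F
        \<longleftrightarrow> (3 / (2 * k)) *\<^sub>R u2 + A u2 + q2 *\<^sub>R n ?x = g ?x"
      by (auto simp: n_def g_def algebra_simps)
    moreover have "(3 * q2 - 4 * q1 + q0) / (2 * k) + \<gamma> * q2 - N (2 *\<^sub>R u1 - u0) \<bullet> u2 = \<gamma>
        \<longleftrightarrow> 3 / (2 * k) * q2 + \<gamma> * q2 - n ?x \<bullet> u2 = h ?x"
      by (auto simp: n_def h_def diff_divide_distrib add_divide_distrib)
    ultimately show ?thesis using R(3)[of u2 q2 "n ?x" "g ?x" "h ?x"] unfolding U_def Q_def by auto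
  qed
  have map_eq: "bdf2_map A N F \<gamma> k x = ((snd (fst x), U x), (snd (snd x), Q x))" for x
  proof -
    obtain u0 u1 q0 q1 where x: "x = ((u0, u1), (q0, q1))" by (metis prod.collapse)
    have "(THE (u2, q2). u2 = U x \<and> q2 = Q x) = (U x, Q x)"
      by (rule the_equality) auto
    then show ?thesis unfolding bdf2_map_def x prod.case system by simp
  qed
  show "continuous_on UNIV (bdf2_map A N F \<gamma> k)" if N: "continuous_on UNIV N"
  proof -
    have cR: "continuous_on UNIV (\<lambda>x. R (f x))" if "continuous_on UNIV f"
      for f :: "('a \<times> 'a) \<times> (real \<times> real) \<Rightarrow> 'a"
      using linear_continuous_on_compose[OF that R(1)] .
    have cn: "continuous_on UNIV n" unfolding n_def
      by (intro continuous_on_compose2[OF N] continuous_intros) auto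
    have cg: "continuous_on UNIV g" and ch: "continuous_on UNIV h" unfolding g_def h_def
      using k by (intro continuous_intros; simp)+
    have cQ: "continuous_on UNIV Q" unfolding Q_def
      using R(2) by (intro continuous_intros cn cg ch cR) (auto simp: less_le)
    have "continuous_on UNIV U" unfolding U_def by (intro cR continuous_intros cg cQ cn)
    then show ?thesis unfolding map_eq by (intro continuous_intros cQ)
  qed
  show "P1 (bdf2_map A N F \<gamma> k x) = P2 x" by (simp add: map_eq P1_def P2_def)
  show "3 *\<^sub>R P2 (bdf2_map A N F \<gamma> k x) - 4 *\<^sub>R P2 x + P1 x =
       (2 * k) *\<^sub>R (let w = fst (2 *\<^sub>R P2 x - P1 x); z = P2 (bdf2_map A N F \<gamma> k x)
         in (F - A (fst z) - snd z *\<^sub>R N w, N w \<bullet> fst z - \<gamma> * snd z + \<gamma>))"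
  proof -
    obtain u0 u1 q0 q1 where x: "x = ((u0, u1), (q0, q1))" by (metis prod.collapse)
    have eq: "(1 / (2 * k)) *\<^sub>R (3 *\<^sub>R U x - 4 *\<^sub>R u1 + u0) + A (U x) + Q x *\<^sub>R N (2 *\<^sub>R u1 - u0) = F"
        "(3 * Q x - 4 * q1 + q0) / (2 * k) + \<gamma> * Q x - N (2 *\<^sub>R u1 - u0) \<bullet> U x = \<gamma>"
      using system[of "U x" u1 u0 "Q x" q1 q0] x by auto
    have "3 *\<^sub>R U x - 4 *\<^sub>R u1 + u0 = (2 * k) *\<^sub>R ((1 / (2 * k)) *\<^sub>R (3 *\<^sub>R U x - 4 *\<^sub>R u1 + u0))"
      using k by simp
    also have "\<dots> = (2 * k) *\<^sub>R (F - A (U x) - Q x *\<^sub>R N (2 *\<^sub>R u1 - u0))"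
      using eq(1) by (intro arg_cong[where f="(*\<^sub>R) (2 * k)"]) (simp add: algebra_simps)
    finally have 1: "3 *\<^sub>R U x - 4 *\<^sub>R u1 + u0 = (2 * k) *\<^sub>R (F - A (U x) - Q x *\<^sub>R N (2 *\<^sub>R u1 - u0))" .
    have "(3 * Q x - 4 * q1 + q0) / (2 * k) = N (2 *\<^sub>R u1 - u0) \<bullet> U x - \<gamma> * Q x + \<gamma>"
      using eq(2) by linarith
    then have 2: "3 * Q x - 4 * q1 + q0 = (2 * k) * (N (2 *\<^sub>R u1 - u0) \<bullet> U x - \<gamma> * Q x + \<gamma>)"
      using k by (simp add: field_simps)
    show ?thesis
      by (simp add: map_eq P1_def P2_def Let_def prod_eq_iff 1 2 x[symmetric]) (use 1 2 x in simp)
  qed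
qed

definition bdf2_energy :: "real \<Rightarrow> real \<Rightarrow> 'z::real_inner \<Rightarrow> 'z \<Rightarrow> real" where
  "bdf2_energy c k z0 z1 = (norm z1)\<^sup>2 + (norm (2 *\<^sub>R z1 - z0))\<^sup>2 + 2 * c * k * (norm z1)\<^sup>2"

lemma bdf2_energy_identity:
  fixes z0 z1 z2 :: "'z::real_inner"
  shows "2 * ((3 *\<^sub>R z2 - 4 *\<^sub>R z1 + z0) \<bullet> z2) = (norm z2)\<^sup>2 + (norm (2 *\<^sub>R z2 - z1))\<^sup>2
    - (norm z1)\<^sup>2 - (norm (2 *\<^sub>R z1 - z0))\<^sup>2 + (norm (z2 - 2 *\<^sub>R z1 + z0))\<^sup>2"
  by (simp add: power2_norm_eq_inner inner_add_left inner_add_right inner_diff_left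
      inner_diff_right inner_commute algebra_simps)

lemma bdf2_energy_contraction:
  fixes z0 z1 z2 v :: "'z::real_inner"
  assumes step: "3 *\<^sub>R z2 - 4 *\<^sub>R z1 + z0 = (2 * k) *\<^sub>R v"
    and diss: "z2 \<bullet> v \<le> C - c * (norm z2)\<^sup>2" and c: "0 < c" and k: "0 < k" "k \<le> 1"
    and \<beta>: "\<beta> = 2 * c / (9 + 2 * c)"
  shows "(1 + \<beta> * k) * (bdf2_energy c k z1 z2 - 4 * C / \<beta>) \<le> bdf2_energy c k z0 z1 - 4 * C / \<beta>"
proof -
  define a b e1 e2 where "a = (norm z2)\<^sup>2" and "b = (norm z1)\<^sup>2"
    and "e1 = (norm z1)\<^sup>2 + (norm (2 *\<^sub>R z1 - z0))\<^sup>2"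
    and "e2 = (norm z2)\<^sup>2 + (norm (2 *\<^sub>R z2 - z1))\<^sup>2"
  have \<beta>0: "0 < \<beta>" and \<beta>c: "\<beta> * (9 + 2 * c) = 2 * c" using c by (auto simp: \<beta>)
  have ab: "0 \<le> a" "0 \<le> b" by (simp_all add: a_def b_def)
  have "e2 - e1 \<le> 2 * ((2 * k) *\<^sub>R v \<bullet> z2)"
    using bdf2_energy_identity[of z2 z1 z0] step by (simp add: e1_def e2_def)
  also have "\<dots> = 4 * k * (z2 \<bullet> v)" by (simp add: inner_commute)
  also have "\<dots> \<le> 4 * k * (C - c * a)" using diss k by (intro mult_left_mono) (auto simp: a_def)
  finally have i: "e2 - e1 \<le> 4 * k * (C - c * a)" .
  have "(norm (2 *\<^sub>R z2 - z1))\<^sup>2 + (norm (2 *\<^sub>R z2 + z1))\<^sup>2 = 8 * a + 2 * b"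
    by (simp add: a_def b_def power2_norm_eq_inner inner_add_left inner_add_right inner_diff_left
        inner_diff_right inner_commute algebra_simps)
  then have "(norm (2 *\<^sub>R z2 - z1))\<^sup>2 \<le> 8 * a + 2 * b"
    using zero_le_power2[of "norm (2 *\<^sub>R z2 + z1)"] by linarith
  then have "e2 + 2 * c * k * a \<le> 9 * a + 2 * b + 2 * c * k * a" by (simp add: e2_def a_def)
  also have "\<dots> \<le> (9 + 2 * c) * (a + b)"
  proof -
    have "2 * c * k * a \<le> 2 * c * 1 * a"
      using k c ab by (intro mult_right_mono mult_left_mono) auto
    moreover have "0 \<le> c * b" using c ab by simp
    ultimately show ?thesis using ab by (simp add: algebra_simps)
  qed
  finally have "\<beta> * k * (e2 + 2 * c * k * a) \<le> \<beta> * k * ((9 + 2 * c) * (a + b))"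
    using \<beta>0 k by (intro mult_left_mono) auto
  also have "\<dots> = (\<beta> * (9 + 2 * c)) * (k * (a + b))" by (simp only: mult_ac)
  finally have ii: "\<beta> * k * (e2 + 2 * c * k * a) \<le> 2 * c * (k * (a + b))" by (simp only: \<beta>c)
  have "(1 + \<beta> * k) * (e2 + 2 * c * k * a - 4 * C / \<beta>) =
      e2 + 2 * c * k * a + \<beta> * k * (e2 + 2 * c * k * a) - 4 * C / \<beta> - 4 * k * C"
    using \<beta>0 by (simp add: field_simps)
  also have "\<dots> \<le> e1 + 2 * c * k * b - 4 * C / \<beta>"
    using i ii by (simp add: algebra_simps)
  finally show ?thesis by (simp add: bdf2_energy_def e1_def e2_def a_def b_def)
qed

lemma bdf2_invariant_bounded:
  fixes p1 p2 :: "'x::topological_space \<Rightarrow> 'z::euclidean_space"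
  assumes inv: "invariant_map T \<mu>" and T: "T \<in> borel_measurable borel"
    and p: "p1 \<in> borel_measurable borel" "p2 \<in> borel_measurable borel" "\<And>x. p1 (T x) = p2 x"
    and step: "\<And>x. 3 *\<^sub>R p2 (T x) - 4 *\<^sub>R p2 x + p1 x = (2 * k) *\<^sub>R g (2 *\<^sub>R p2 x - p1 x) (p2 (T x))"
    and diss: "\<And>w z. z \<bullet> g w z \<le> C - c * (norm z)\<^sup>2"
    and c: "0 < c" and k: "0 < k" "k \<le> 1" and R: "R = 3 * sqrt (2 * C * (9 + 2 * c) / c)"
  shows "AE x in \<mu>. norm (p1 x) \<le> R \<and> norm (p2 x) \<le> R"
proof -
  define \<beta> where "\<beta> = 2 * c / (9 + 2 * c)"
  have \<beta>: "0 < \<beta>" using c by (simp add: \<beta>_def)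
  have "AE x in \<mu>. bdf2_energy c k (p1 x) (p2 x) - 4 * C / \<beta> \<le> 0"
  proof (rule invariant_map_AE_contraction[OF inv T, where \<rho>="1 + \<beta> * k"])
    show "(\<lambda>x. bdf2_energy c k (p1 x) (p2 x) - 4 * C / \<beta>) \<in> borel_measurable borel"
      unfolding bdf2_energy_def using p(1,2) by measurable
    show "AE x in \<mu>. (1 + \<beta> * k) * (bdf2_energy c k (p1 (T x)) (p2 (T x)) - 4 * C / \<beta>)
        \<le> bdf2_energy c k (p1 x) (p2 x) - 4 * C / \<beta>"
      unfolding p(3) by (intro AE_I2 bdf2_energy_contraction[OF step diss c k \<beta>_def])
  qed (use \<beta> k in simp)
  then show ?thesis
  proof eventually_elim
    fix x assume le: "bdf2_energy c k (p1 x) (p2 x) - 4 * C / \<beta> \<le> 0"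
    define r where "r = sqrt (2 * C * (9 + 2 * c) / c)"
    have "4 * C / \<beta> = 2 * C * (9 + 2 * c) / c" using c by (simp add: \<beta>_def field_simps)
    moreover have "0 \<le> 2 * c * k * (norm (p2 x))\<^sup>2" using c k by simp
    ultimately have "(norm (p2 x))\<^sup>2 + (norm (2 *\<^sub>R p2 x - p1 x))\<^sup>2 \<le> 2 * C * (9 + 2 * c) / c"
      using le by (simp add: bdf2_energy_def)
    then have "(norm (p2 x))\<^sup>2 \<le> 2 * C * (9 + 2 * c) / c"
        "(norm (2 *\<^sub>R p2 x - p1 x))\<^sup>2 \<le> 2 * C * (9 + 2 * c) / c"
      using zero_le_power2[of "norm (p2 x)"] zero_le_power2[of "norm (2 *\<^sub>R p2 x - p1 x)"]
      by linarith+
    then have "norm (p2 x) \<le> r" "norm (2 *\<^sub>R p2 x - p1 x) \<le> r"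
      by (simp_all add: r_def real_le_rsqrt)
    moreover have "norm (p1 x) \<le> norm (2 *\<^sub>R p2 x) + norm (2 *\<^sub>R p2 x - p1 x)"
      using norm_triangle_ineq4[of "2 *\<^sub>R p2 x" "2 *\<^sub>R p2 x - p1 x"] by simp
    ultimately show "norm (p1 x) \<le> R \<and> norm (p2 x) \<le> R"
      using order_trans[OF norm_ge_zero \<open>norm (p2 x) \<le> r\<close>] unfolding R r_def[symmetric] by auto
  qed
qed

lemma bdf2_invariant_increment:
  fixes p1 p2 :: "'x::topological_space \<Rightarrow> 'z::euclidean_space"
  assumes inv: "invariant_map T \<mu>" and T: "T \<in> borel_measurable borel"
    and p: "p1 \<in> borel_measurable borel" "p2 \<in> borel_measurable borel" "\<And>x. p1 (T x) = p2 x"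
    and step: "\<And>x. 3 *\<^sub>R p2 (T x) - 4 *\<^sub>R p2 x + p1 x = (2 * k) *\<^sub>R g (2 *\<^sub>R p2 x - p1 x) (p2 (T x))"
    and bound: "AE x in \<mu>. norm (p1 x) \<le> R \<and> norm (p2 x) \<le> R"
    and G: "\<And>w z. norm w \<le> 3 * R \<Longrightarrow> norm z \<le> 3 * R \<Longrightarrow> norm (g w z) \<le> G" and k: "0 < k"
  shows "AE x in \<mu>. norm (p2 x - p1 x) \<le> G * k"
proof -
  have "AE x in \<mu>. norm (p2 x - p1 x) - G * k \<le> 0"
  proof (rule invariant_map_AE_contraction[OF inv T, where \<rho>=3])
    show "(\<lambda>x. norm (p2 x - p1 x) - G * k) \<in> borel_measurable borel"
      using p(1,2) by measurable
    show "AE x in \<mu>. 3 * (norm (p2 (T x) - p1 (T x)) - G * k) \<le> norm (p2 x - p1 x) - G * k"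
      using bound invariant_map_AE_compose[OF inv T bound]
    proof eventually_elim
      fix x assume x: "norm (p1 x) \<le> R \<and> norm (p2 x) \<le> R"
        "norm (p1 (T x)) \<le> R \<and> norm (p2 (T x)) \<le> R"
      have "norm (2 *\<^sub>R p2 x - p1 x) \<le> 3 * R"
        using x norm_triangle_ineq4[of "2 *\<^sub>R p2 x" "p1 x"] by simp
      moreover have "norm (p2 (T x)) \<le> 3 * R" using x norm_ge_zero[of "p2 (T x)"] by linarith
      ultimately have v: "norm (g (2 *\<^sub>R p2 x - p1 x) (p2 (T x))) \<le> G" by (rule G)
      have "3 *\<^sub>R (p2 (T x) - p1 (T x)) = (p2 x - p1 x) + (3 *\<^sub>R p2 (T x) - 4 *\<^sub>R p2 x + p1 x)"
        using scaleR_add_left[of 3 1 "p2 x"] by (simp add: p(3) algebra_simps)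
      then have "norm (3 *\<^sub>R (p2 (T x) - p1 (T x))) \<le> norm (p2 x - p1 x)
          + norm ((2 * k) *\<^sub>R g (2 *\<^sub>R p2 x - p1 x) (p2 (T x)))"
        unfolding step by (metis norm_triangle_ineq)
      also have "\<dots> \<le> norm (p2 x - p1 x) + 2 * k * G"
        using v k by (simp add: mult_left_mono)
      finally show "3 * (norm (p2 (T x) - p1 (T x)) - G * k) \<le> norm (p2 x - p1 x) - G * k"
        by (simp add: mult_ac)
    qed
  qed simp
  then show ?thesis by simp
qed

lemma bdf2_consistency:
  fixes z0 z1 z2 :: "'z::real_normed_vector"
  assumes step: "3 *\<^sub>R z2 - 4 *\<^sub>R z1 + z0 = (2 * k) *\<^sub>R g (2 *\<^sub>R z1 - z0) z2"
    and incr: "norm (z1 - z0) \<le> G * k" "norm (z2 - z1) \<le> G * k" and k: "0 < k"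
    and y: "y = (3/2) *\<^sub>R z1 - (1/2) *\<^sub>R z0"
    and lip: "norm (g (2 *\<^sub>R z1 - z0) z2 - g y y) \<le> L * (norm (2 *\<^sub>R z1 - z0 - y) + norm (z2 - y))"
    and L: "0 \<le> L"
  shows "norm ((3/2) *\<^sub>R z2 - (1/2) *\<^sub>R z1 - y - k *\<^sub>R g y y) \<le> 2 * L * G * k\<^sup>2"
proof -
  have "(3/2) *\<^sub>R z2 - (1/2) *\<^sub>R z1 - y = (1/2) *\<^sub>R (3 *\<^sub>R z2 - 4 *\<^sub>R z1 + z0)"
    by (simp add: y algebra_simps flip: scaleR_add_left)
  then have "(3/2) *\<^sub>R z2 - (1/2) *\<^sub>R z1 - y - k *\<^sub>R g y y = k *\<^sub>R (g (2 *\<^sub>R z1 - z0) z2 - g y y)"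
    unfolding step by (simp add: algebra_simps)
  then have "norm ((3/2) *\<^sub>R z2 - (1/2) *\<^sub>R z1 - y - k *\<^sub>R g y y)
      = k * norm (g (2 *\<^sub>R z1 - z0) z2 - g y y)" using k by simp
  also have "\<dots> \<le> k * (L * (norm (2 *\<^sub>R z1 - z0 - y) + norm (z2 - y)))"
    using lip k by (intro mult_left_mono) auto
  also have "\<dots> \<le> k * (L * (2 * G * k))"
  proof (intro mult_left_mono)
    have "2 *\<^sub>R z1 - z0 - y = (1/2) *\<^sub>R (z1 - z0)"
      by (simp add: y algebra_simps flip: scaleR_add_left scaleR_diff_left)
    then have 1: "norm (2 *\<^sub>R z1 - z0 - y) = norm (z1 - z0) / 2" by simp
    have eq: "z2 - y = (z2 - z1) - (1/2) *\<^sub>R (z1 - z0)"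
      using scaleR_add_left[of 1 "1/2" z1] by (simp add: y algebra_simps)
    have 2: "norm (z2 - y) \<le> norm (z2 - z1) + norm (z1 - z0) / 2"
      using norm_triangle_ineq4[of "z2 - z1" "(1/2) *\<^sub>R (z1 - z0)"] unfolding eq by simp
    show "norm (2 *\<^sub>R z1 - z0 - y) + norm (z2 - y) \<le> 2 * G * k"
      using 1 2 incr by linarith
  qed (use k L in auto)
  finally show ?thesis by (simp add: power2_eq_square mult_ac)
qed

definition sav_field :: "('a::real_inner \<Rightarrow> 'a) \<Rightarrow> ('a \<Rightarrow> 'a) \<Rightarrow> 'a \<Rightarrow> real \<Rightarrow> 'a \<times> real \<Rightarrow> 'a \<times> real \<Rightarrow> 'a \<times> real"
  where "sav_field A N F \<gamma> w z =
    (F - A (fst z) - snd z *\<^sub>R N (fst w), N (fst w) \<bullet> fst z - \<gamma> * snd z + \<gamma>)"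

lemma sav_field_dissipative:
  assumes l0: "0 < l0" "\<And>u. A u \<bullet> u \<ge> l0 * (norm u)\<^sup>2" and \<gamma>: "0 < \<gamma>"
  shows "z \<bullet> sav_field A N F \<gamma> w z \<le> (norm F)\<^sup>2 / (2 * l0) + \<gamma> / 2 - min l0 \<gamma> / 2 * (norm z)\<^sup>2"
proof -
  define u q where "u = fst z" and "q = snd z"
  have "F \<bullet> u \<le> norm F * norm u" by (rule norm_cauchy_schwarz)
  also have "\<dots> \<le> (norm F)\<^sup>2 / (2 * l0) + l0 / 2 * (norm u)\<^sup>2"
  proof -
    have "0 \<le> (norm F - l0 * norm u)\<^sup>2 / (2 * l0)" using l0 by simp
    also have "\<dots> = (norm F)\<^sup>2 / (2 * l0) + l0 / 2 * (norm u)\<^sup>2 - norm F * norm u"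
      using l0 by (simp add: power2_eq_square field_simps)
    finally show ?thesis by simp
  qed
  finally have 1: "F \<bullet> u \<le> (norm F)\<^sup>2 / (2 * l0) + l0 / 2 * (norm u)\<^sup>2" .
  have "0 \<le> \<gamma> / 2 * (q - 1)\<^sup>2" using \<gamma> by simp
  then have 2: "\<gamma> * q \<le> \<gamma> / 2 + \<gamma> / 2 * q\<^sup>2" by (simp add: power2_eq_square algebra_simps)
  have "z \<bullet> sav_field A N F \<gamma> w z = F \<bullet> u - A u \<bullet> u - \<gamma> * q\<^sup>2 + \<gamma> * q"
    by (simp add: sav_field_def u_def q_def inner_prod_def inner_diff_right inner_commute
        power2_eq_square algebra_simps)
  also have "\<dots> \<le> (norm F)\<^sup>2 / (2 * l0) + \<gamma> / 2 - l0 / 2 * (norm u)\<^sup>2 - \<gamma> / 2 * q\<^sup>2"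
    using 1 2 l0(2)[of u] by (simp add: algebra_simps)
  also have "\<dots> \<le> (norm F)\<^sup>2 / (2 * l0) + \<gamma> / 2 - min l0 \<gamma> / 2 * (norm u)\<^sup>2 - min l0 \<gamma> / 2 * q\<^sup>2"
    by (intro diff_mono mult_right_mono) auto
  also have "\<dots> = (norm F)\<^sup>2 / (2 * l0) + \<gamma> / 2 - min l0 \<gamma> / 2 * (norm z)\<^sup>2"
    by (cases z) (simp add: u_def q_def norm_Pair algebra_simps)
  finally show ?thesis .
qed

lemma sav_field_lipschitz:
  fixes A N :: "'a::euclidean_space \<Rightarrow> 'a"
  assumes A: "linear A" and N: "LN-lipschitz_on (cball 0 R) N" and \<gamma>: "0 \<le> \<gamma>" and R: "0 \<le> R"
  obtains L where "0 \<le> L" "\<And>w z w' z'. norm w \<le> R \<Longrightarrow> norm z \<le> R \<Longrightarrow> norm w' \<le> R \<Longrightarrow> norm z' \<le> R \<Longrightarrow>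
    norm (sav_field A N F \<gamma> w z - sav_field A N F \<gamma> w' z') \<le> L * (norm (w - w') + norm (z - z'))"
proof -
  obtain KA where KA: "0 < KA" "\<And>u. norm (A u) \<le> KA * norm u" using linear_bounded_pos[OF A] by blast
  have "bounded (N ` cball 0 R)"
    by (intro compact_imp_bounded compact_continuous_image lipschitz_on_continuous_on[OF N]) simp
  then obtain B where B: "0 < B" "\<And>u. u \<in> cball 0 R \<Longrightarrow> norm (N u) \<le> B"
    unfolding bounded_pos by (metis imageI)
  have LN: "0 \<le> LN" by (rule lipschitz_on_nonneg[OF N])
  define L where "L = KA + 2 * B + \<gamma> + 2 * R * LN"
  have "norm (sav_field A N F \<gamma> w z - sav_field A N F \<gamma> w' z') \<le> L * (norm (w - w') + norm (z - z'))"
    if "norm w \<le> R" "norm z \<le> R" "norm w' \<le> R" "norm z' \<le> R" for w z w' z'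
  proof -
    have norm_fst: "norm (fst v) \<le> norm v" and norm_snd: "\<bar>snd v\<bar> \<le> norm v" for v :: "'a \<times> real"
      using norm_fst_le[of "fst v" "snd v"] norm_snd_le[of "snd v" "fst v"] by simp_all
    have ball: "fst w \<in> cball 0 R" "fst w' \<in> cball 0 R" and le: "norm (fst z) \<le> R" "\<bar>snd z\<bar> \<le> R"
      using that norm_fst[of w] norm_fst[of w'] norm_fst[of z] norm_snd[of z] by auto
    define dz dw where "dz = norm (z - z')" and "dw = norm (w - w')"
    have d: "norm (fst z - fst z') \<le> dz" "\<bar>snd z - snd z'\<bar> \<le> dz" "norm (fst w - fst w') \<le> dw"
      unfolding dz_def dw_def
      using norm_fst[of "z - z'"] norm_snd[of "z - z'"] norm_fst[of "w - w'"] by simp_all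
    have d0: "0 \<le> dz" "0 \<le> dw" by (simp_all add: dz_def dw_def)
    have Nd: "norm (N (fst w) - N (fst w')) \<le> LN * dw"
      using lipschitz_onD[OF N ball] d(3) LN mult_left_mono[OF d(3) LN] by (simp add: dist_norm)
    have Ad: "norm (A (fst z - fst z')) \<le> KA * dz"
      using KA(2)[of "fst z - fst z'"] mult_left_mono[OF d(1), of KA] KA(1) by linarith
    have qN: "norm (snd z *\<^sub>R N (fst w) - snd z' *\<^sub>R N (fst w')) \<le> R * (LN * dw) + dz * B"
    proof -
      have "snd z *\<^sub>R N (fst w) - snd z' *\<^sub>R N (fst w')
          = snd z *\<^sub>R (N (fst w) - N (fst w')) + (snd z - snd z') *\<^sub>R N (fst w')"
        by (simp add: algebra_simps)
      also have "norm \<dots> \<le> \<bar>snd z\<bar> * norm (N (fst w) - N (fst w')) + \<bar>snd z - snd z'\<bar> * norm (N (fst w'))"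
        by (rule order_trans[OF norm_triangle_ineq]) simp
      also have "\<dots> \<le> R * (LN * dw) + dz * B"
        using le d Nd B(2)[OF ball(2)] R d0 by (intro add_mono mult_mono) auto
      finally show ?thesis .
    qed
    have Nu: "\<bar>N (fst w) \<bullet> fst z - N (fst w') \<bullet> fst z'\<bar> \<le> LN * dw * R + B * dz"
    proof -
      have "N (fst w) \<bullet> fst z - N (fst w') \<bullet> fst z'
          = (N (fst w) - N (fst w')) \<bullet> fst z + N (fst w') \<bullet> (fst z - fst z')"
        by (simp add: inner_diff_left inner_diff_right)
      also have "\<bar>\<dots>\<bar> \<le> norm (N (fst w) - N (fst w')) * norm (fst z) + norm (N (fst w')) * norm (fst z - fst z')"
        by (rule order_trans[OF abs_triangle_ineq]) (intro add_mono Cauchy_Schwarz_ineq2)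
      also have "\<dots> \<le> LN * dw * R + B * dz"
        using le d Nd B R d0 LN ball by (intro add_mono mult_mono) auto
      finally show ?thesis .
    qed
    have "norm (sav_field A N F \<gamma> w z - sav_field A N F \<gamma> w' z')
        \<le> norm (fst (sav_field A N F \<gamma> w z - sav_field A N F \<gamma> w' z'))
          + norm (snd (sav_field A N F \<gamma> w z - sav_field A N F \<gamma> w' z'))"
      using norm_Pair_le by (metis prod.collapse)
    also have "\<dots> \<le> (KA * dz + (R * (LN * dw) + dz * B)) + (LN * dw * R + B * dz + \<gamma> * dz)"
    proof (rule add_mono)
      have "fst (sav_field A N F \<gamma> w z - sav_field A N F \<gamma> w' z')
          = - (A (fst z - fst z')) - (snd z *\<^sub>R N (fst w) - snd z' *\<^sub>R N (fst w'))"
        by (simp add: sav_field_def linear_diff[OF A])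
      then show "norm (fst (sav_field A N F \<gamma> w z - sav_field A N F \<gamma> w' z'))
          \<le> KA * dz + (R * (LN * dw) + dz * B)"
        using Ad qN norm_triangle_ineq4[of "- (A (fst z - fst z'))" "snd z *\<^sub>R N (fst w) - snd z' *\<^sub>R N (fst w')"]
        by simp
      have "snd (sav_field A N F \<gamma> w z - sav_field A N F \<gamma> w' z')
          = (N (fst w) \<bullet> fst z - N (fst w') \<bullet> fst z') - \<gamma> * (snd z - snd z')"
        by (simp add: sav_field_def algebra_simps)
      moreover have "\<bar>\<gamma> * (snd z - snd z')\<bar> \<le> \<gamma> * dz"
        using \<gamma> d(2) by (simp add: abs_mult mult_left_mono)
      ultimately show "norm (snd (sav_field A N F \<gamma> w z - sav_field A N F \<gamma> w' z'))
          \<le> LN * dw * R + B * dz + \<gamma> * dz"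
        using Nu by simp
    qed
    also have "\<dots> = (KA + 2 * B + \<gamma>) * dz + 2 * R * LN * dw" by (simp add: algebra_simps)
    also have "\<dots> \<le> L * dz + L * dw"
    proof (rule add_mono)
      show "(KA + 2 * B + \<gamma>) * dz \<le> L * dz"
        using R LN d0 by (intro mult_right_mono) (auto simp: L_def)
      show "2 * R * LN * dw \<le> L * dw"
        using KA(1) B(1) \<gamma> d0 by (intro mult_right_mono) (auto simp: L_def)
    qed
    finally show ?thesis by (simp add: dz_def dw_def algebra_simps)
  qed
  moreover have "0 \<le> L" unfolding L_def using KA(1) B(1) \<gamma> R LN by simp
  ultimately show ?thesis using that by blast
qed

lemma invariant_semigroup_projection:
  fixes A N :: "'a::euclidean_space \<Rightarrow> 'a" and S :: "real \<Rightarrow> 'a \<Rightarrow> 'a"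
    and Sq :: "real \<Rightarrow> 'a \<times> real \<Rightarrow> 'a \<times> real"
  assumes N_orth: "\<And>u. N u \<bullet> u = 0" and \<gamma>: "0 < \<gamma>"
    and S_init: "\<And>u. S 0 u = u"
    and S_ode: "\<And>u t. 0 \<le> t \<Longrightarrow>
        ((\<lambda>s. S s u) has_vector_derivative (F - A (S t u) - N (S t u))) (at t within {0..})"
    and Sq_init: "\<And>z. Sq 0 z = z"
    and Sq_ode: "\<And>z t. 0 \<le> t \<Longrightarrow>
        ((\<lambda>s. Sq s z) has_vector_derivative sav_field A N F \<gamma> (Sq t z) (Sq t z)) (at t within {0..})"
    and lip: "\<And>R. \<exists>L. L-lipschitz_on (cball 0 R) (\<lambda>z. sav_field A N F \<gamma> z z)"
    and Sq_cont: "\<And>t. 0 \<le> t \<Longrightarrow> continuous_on UNIV (Sq t)"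
    and inv: "invariant_semigroup Sq \<nu>"
  shows "invariant_semigroup S (distr \<nu> borel Pu)"
proof -
  have S_eq: "(S t u, 1) = Sq t (u, 1)" if t: "0 \<le> t" for t u
  proof -
    define x where "x s = (S s u, 1::real)" for s
    have x: "(x has_vector_derivative sav_field A N F \<gamma> (x s) (x s)) (at s within {0..})"
      if "0 \<le> s" for s
      unfolding x_def sav_field_def
      using has_vector_derivative_Pair[OF S_ode[OF that, of u] has_vector_derivative_const[of 1]]
      by (simp add: N_orth)
    have y: "((\<lambda>s. Sq s (u, 1)) has_vector_derivative
        sav_field A N F \<gamma> (Sq s (u, 1)) (Sq s (u, 1))) (at s within {0..})" if "0 \<le> s" for s
      by (rule Sq_ode[OF that])
    have cont: "continuous_on {0..t} f"
      if "\<And>s. 0 \<le> s \<Longrightarrow> (f has_vector_derivative f' s) (at s within {0..})"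
      for f f' :: "real \<Rightarrow> 'a \<times> real"
      unfolding continuous_on_eq_continuous_within
    proof
      fix s assume "s \<in> {0..t}"
      then show "continuous (at s within {0..t}) f"
        using continuous_within_subset[OF has_vector_derivative_continuous[OF that[of s]]] by auto
    qed
    have "bounded (x ` {0..t} \<union> (\<lambda>s. Sq s (u, 1)) ` {0..t})"
      by (intro bounded_Un[THEN iffD2] conjI compact_imp_bounded compact_continuous_image
          cont[OF x] cont[OF y]) auto
    then obtain R where "\<And>z. z \<in> x ` {0..t} \<union> (\<lambda>s. Sq s (u, 1)) ` {0..t} \<Longrightarrow> norm z \<le> R"
      unfolding bounded_iff by blast
    then have R: "x s \<in> cball 0 R" "Sq s (u, 1) \<in> cball 0 R" if "s \<in> {0..t}" for s
      using that by auto
    obtain L where L: "L-lipschitz_on (cball 0 R) (\<lambda>z. sav_field A N F \<gamma> z z)" using lip by blast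
    have "norm (x t - Sq t (u, 1)) \<le> exp (L * t) * norm (x 0 - Sq 0 (u, 1))"
      by (rule ode_gronwall[OF t x y R L])
    then show ?thesis by (simp add: x_def S_init Sq_init)
  qed
  have q_eq: "exp (\<gamma> * t) * (snd (Sq t z) - 1) = snd z - 1" if t: "0 \<le> t" for t z
  proof -
    define q where "q s = snd (Sq s z)" for s
    define h where "h s = exp (\<gamma> * s) * (q s - 1)" for s
    have der: "(h has_derivative (\<lambda>r. r * 0)) (at s within {0..t})" if "0 \<le> s" "s \<le> t" for s
    proof -
      have "((\<lambda>s. Sq s z) has_derivative (\<lambda>r. r *\<^sub>R sav_field A N F \<gamma> (Sq s z) (Sq s z)))
          (at s within {0..t})"
        using Sq_ode[OF that(1), of z]
        by (auto simp: has_vector_derivative_def intro: has_derivative_subset)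
      from has_derivative_snd[OF this]
      have "(q has_derivative (\<lambda>r. r * (\<gamma> - \<gamma> * q s))) (at s within {0..t})"
        by (simp add: sav_field_def N_orth q_def[abs_def])
      then show ?thesis unfolding h_def
        by (auto intro!: derivative_eq_intros simp: algebra_simps)
    qed
    have "h t = h 0" using mvt_very_simple[OF t der] by auto
    then show ?thesis by (simp add: h_def q_def Sq_init)
  qed
  have \<nu>: "borel_prob \<nu>" using inv by (auto simp: invariant_semigroup_def invariant_map_def)
  note b = borel_probD[OF \<nu>]
  have Pu_cont: "continuous_on UNIV (Pu :: 'a \<times> real \<Rightarrow> 'a)"
    unfolding Pu_def[abs_def] by (intro continuous_intros)
  have Pu_meas: "Pu \<in> borel_measurable (borel :: ('a \<times> real) measure)"
    by (rule borel_measurable_continuous_onI[OF Pu_cont])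
  have Sq_meas: "Sq t \<in> borel_measurable borel" if "0 \<le> t" for t
    by (rule borel_measurable_continuous_onI[OF Sq_cont[OF that]])
  have inv_map: "invariant_map (Sq t) \<nu>" if "0 \<le> t" for t
    using inv that by (auto simp: invariant_semigroup_def)
  have "AE z in \<nu>. \<bar>snd z - 1\<bar> \<le> 0"
  proof (rule invariant_map_AE_contraction[OF inv_map Sq_meas, of 1 _ "exp \<gamma>"])
    show "(\<lambda>z::'a \<times> real. \<bar>snd z - 1\<bar>) \<in> borel_measurable borel"
      by (intro borel_measurable_continuous_onI continuous_intros)
    show "AE z in \<nu>. exp \<gamma> * \<bar>snd (Sq 1 z) - 1\<bar> \<le> \<bar>snd z - 1\<bar>"
    proof (rule AE_I2)
      fix z
      have "\<bar>snd z - 1\<bar> = \<bar>exp \<gamma> * (snd (Sq 1 z) - 1)\<bar>" using q_eq[of 1 z] by simp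
      then show "exp \<gamma> * \<bar>snd (Sq 1 z) - 1\<bar> \<le> \<bar>snd z - 1\<bar>" by (simp add: abs_mult)
    qed
  qed (use \<gamma> in auto)
  then have q1: "AE z in \<nu>. snd z = 1" by simp
  show ?thesis
    unfolding invariant_semigroup_def
  proof (intro allI impI)
    fix t :: real assume t: "0 \<le> t"
    have "S t = (\<lambda>u. fst (Sq t (u, 1)))" using S_eq[OF t] by (metis fst_conv)
    moreover have "continuous_on UNIV (\<lambda>u. fst (Sq t (u, 1)))"
      by (intro continuous_on_fst continuous_on_compose2[OF Sq_cont[OF t]] continuous_intros) auto
    ultimately have S_meas: "S t \<in> borel_measurable borel"
      using borel_measurable_continuous_onI by metis
    have "emeasure (distr \<nu> borel Pu) (S t -` B) = emeasure (distr \<nu> borel Pu) B"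
      if B: "B \<in> sets borel" for B
    proof -
      have Pu_\<nu>: "Pu \<in> borel_measurable \<nu>" using Pu_meas b measurable_cong_sets by blast
      have SB: "S t -` B \<in> sets borel" using measurable_sets[OF S_meas B] by simp
      have PB: "Pu -` B \<in> sets (borel :: ('a \<times> real) measure)"
        using measurable_sets[OF Pu_meas B] by simp
      have PSB: "Pu -` (S t -` B) \<in> sets (borel :: ('a \<times> real) measure)"
        using measurable_sets[OF Pu_meas SB] by simp
      have SPB: "Sq t -` (Pu -` B) \<in> sets borel" using measurable_sets[OF Sq_meas[OF t] PB] by simp
      have "emeasure (distr \<nu> borel Pu) (S t -` B) = emeasure \<nu> (Pu -` (S t -` B))"
        using SB Pu_\<nu> by (simp add: emeasure_distr b)
      also have "\<dots> = emeasure \<nu> (Sq t -` (Pu -` B))"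
      proof (rule emeasure_eq_AE)
        show "AE z in \<nu>. z \<in> Pu -` (S t -` B) \<longleftrightarrow> z \<in> Sq t -` (Pu -` B)"
          using q1
        proof eventually_elim
          fix z :: "'a \<times> real" assume "snd z = 1"
          then have "Sq t z = (S t (fst z), 1)" using S_eq[OF t, of "fst z"] by (metis prod.collapse)
          then show "z \<in> Pu -` (S t -` B) \<longleftrightarrow> z \<in> Sq t -` (Pu -` B)" by (simp add: Pu_def)
        qed
      qed (use PSB SPB b in auto)
      also have "\<dots> = emeasure \<nu> (Pu -` B)"
        using inv_map[OF t] PB unfolding invariant_map_def by blast
      also have "\<dots> = emeasure (distr \<nu> borel Pu) B"
        using B Pu_\<nu> by (simp add: emeasure_distr b)
      finally show ?thesis .
    qed
    then show "invariant_map (S t) (distr \<nu> borel Pu)"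
      unfolding invariant_map_def using borel_prob_distr[OF \<nu> Pu_meas] by blast
  qed
qed

lemma weak_conv_distr:
  assumes conv: "weak_conv M M0" and M: "\<And>n. borel_prob (M n)" "borel_prob M0"
    and h: "continuous_on UNIV h"
  shows "weak_conv (\<lambda>n. distr (M n) borel h) (distr M0 borel h)"
  unfolding weak_conv_def
proof (intro allI impI, elim conjE)
  fix f :: "'b \<Rightarrow> real" assume f: "continuous_on UNIV f" "bounded (range f)"
  have eq: "integral\<^sup>L (distr \<nu> borel h) f = integral\<^sup>L \<nu> (\<lambda>x. f (h x))" if "borel_prob \<nu>" for \<nu>
  proof (rule integral_distr)
    show "h \<in> borel_measurable \<nu>"
      using borel_measurable_continuous_onI[OF h] borel_probD[OF that] measurable_cong_sets by blast
    show "f \<in> borel_measurable borel" by (rule borel_measurable_continuous_onI[OF f(1)])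
  qed
  have "continuous_on UNIV (\<lambda>x. f (h x))" by (rule continuous_on_compose2[OF f(1) h]) simp
  moreover have "bounded (range (\<lambda>x. f (h x)))" by (rule bounded_subset[OF f(2)]) auto
  ultimately show "(\<lambda>n. integral\<^sup>L (distr (M n) borel h) f) \<longlonglongrightarrow> integral\<^sup>L (distr M0 borel h) f"
    using conv unfolding weak_conv_def eq[OF M(1)] eq[OF M(2)] by blast
qed

theorem theorem2:
  fixes A N :: "'a::euclidean_space \<Rightarrow> 'a" and F :: 'a and \<gamma> l0 :: real
    and S :: "real \<Rightarrow> 'a \<Rightarrow> 'a"
    and Sq :: "real \<Rightarrow> 'a \<times> real \<Rightarrow> 'a \<times> real"
    and \<mu> :: "real \<Rightarrow> (('a \<times> 'a) \<times> (real \<times> real)) measure"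
  assumes A_lin: "linear A"
    and A_sym: "\<And>u v. A u \<bullet> v = u \<bullet> A v"
    and l0_pos: "l0 > 0"
    and A_coercive: "\<And>u. A u \<bullet> u \<ge> l0 * (norm u)\<^sup>2"
    and N_loclip: "locally_lipschitz N"
    and N_orth: "\<And>u. N u \<bullet> u = 0"
    and gamma_pos: "\<gamma> > 0"
    and S_init: "\<And>u0. S 0 u0 = u0"
    and S_ode: "\<And>u0 t. t \<ge> 0 \<Longrightarrow>
        ((\<lambda>s. S s u0) has_vector_derivative (F - A (S t u0) - N (S t u0))) (at t within {0..})"
    and Sq_init: "\<And>x0. Sq 0 x0 = x0"
    and Sq_ode: "\<And>x0 t. t \<ge> 0 \<Longrightarrow>
        ((\<lambda>s. Sq s x0) has_vector_derivative
           (F - A (fst (Sq t x0)) - snd (Sq t x0) *\<^sub>R N (fst (Sq t x0)),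
            N (fst (Sq t x0)) \<bullet> fst (Sq t x0) - \<gamma> * snd (Sq t x0) + \<gamma>)) (at t within {0..})"
    and mu_inv: "\<And>k. k \<in> {0<..1} \<Longrightarrow> invariant_map (bdf2_map A N F \<gamma> k) (\<mu> k)"
  shows "\<exists>kn :: nat \<Rightarrow> real. \<exists>\<mu>0.
           (\<forall>n. kn n \<in> {0<..1}) \<and> kn \<longlonglongrightarrow> 0 \<and>
           borel_prob \<mu>0 \<and> weak_conv (\<lambda>n. \<mu> (kn n)) \<mu>0 \<and>
           (\<forall>P \<in> {P1, P2}.
              invariant_semigroup Sq (distr \<mu>0 borel P) \<and>
              weak_conv (\<lambda>n. distr (distr (\<mu> (kn n)) borel P) borel Pu)
                        (distr (distr \<mu>0 borel P) borel Pu) \<and>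
              invariant_semigroup S (distr (distr \<mu>0 borel P) borel Pu))"
proof -
  define g where "g = sav_field A N F \<gamma>"
  define T where "T = bdf2_map A N F \<gamma>"
  define c where "c = min l0 \<gamma> / 2"
  define C where "C = (norm F)\<^sup>2 / (2 * l0) + \<gamma> / 2"
  define R where "R = 3 * sqrt (2 * C * (9 + 2 * c) / c)"
  have A_nonneg: "0 \<le> A u \<bullet> u" for u
    using A_coercive[of u] l0_pos by (meson order_trans mult_nonneg_nonneg less_imp_le zero_le_power2)
  have c: "0 < c" using l0_pos gamma_pos by (simp add: c_def)
  have C0: "0 \<le> C" using l0_pos gamma_pos by (simp add: C_def)
  have R0: "0 \<le> R" using c C0 by (simp add: R_def)
  have diss: "z \<bullet> g w z \<le> C - c * (norm z)\<^sup>2" for w z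
    unfolding g_def C_def c_def by (rule sav_field_dissipative[OF l0_pos A_coercive gamma_pos])
  have diss': "z \<bullet> g z z \<le> C" for z
    using diss[of z z] mult_nonneg_nonneg[OF less_imp_le[OF c] zero_le_power2[of "norm z"]] by linarith
  have g_lip: "\<exists>L\<ge>0. \<forall>w z w' z'. norm w \<le> r \<longrightarrow> norm z \<le> r \<longrightarrow> norm w' \<le> r \<longrightarrow> norm z' \<le> r \<longrightarrow>
      norm (g w z - g w' z') \<le> L * (norm (w - w') + norm (z - z'))" if "0 \<le> r" for r
  proof -
    obtain LN where "LN-lipschitz_on (cball 0 r) N"
      using locally_lipschitz_imp_lipschitz_compact[OF N_loclip compact_cball] by blast
    from sav_field_lipschitz[OF A_lin this less_imp_le[OF gamma_pos] that, of F]
    show ?thesis unfolding g_def by metis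
  qed
  have lip: "\<exists>L. L-lipschitz_on (cball 0 r) (\<lambda>z. g z z)" for r
  proof (cases "0 \<le> r")
    case True
    then obtain L where L: "0 \<le> L" "\<And>w z w' z'. norm w \<le> r \<Longrightarrow> norm z \<le> r \<Longrightarrow> norm w' \<le> r \<Longrightarrow>
        norm z' \<le> r \<Longrightarrow> norm (g w z - g w' z') \<le> L * (norm (w - w') + norm (z - z'))"
      using g_lip[of r] by metis
    have "(2 * L)-lipschitz_on (cball 0 r) (\<lambda>z. g z z)"
    proof (rule lipschitz_onI)
      fix z z' :: "'a \<times> real" assume "z \<in> cball 0 r" "z' \<in> cball 0 r"
      then show "dist (g z z) (g z' z') \<le> 2 * L * dist z z'"
        using L(2)[of z z z' z'] by (simp add: dist_norm)
    qed (use L in simp)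
    then show ?thesis by blast
  next
    case False
    then show ?thesis by (auto simp: lipschitz_on_def intro!: exI[of _ 0])
  qed
  obtain L where L: "0 \<le> L" "\<And>w z w' z'. norm w \<le> 3 * R \<Longrightarrow> norm z \<le> 3 * R \<Longrightarrow> norm w' \<le> 3 * R \<Longrightarrow>
      norm z' \<le> 3 * R \<Longrightarrow> norm (g w z - g w' z') \<le> L * (norm (w - w') + norm (z - z'))"
    using g_lip[of "3 * R"] R0 by (metis mult_nonneg_nonneg zero_le_numeral)
  define G where "G = norm (g 0 0) + 6 * L * R"
  have G: "norm (g w z) \<le> G" if "norm w \<le> 3 * R" "norm z \<le> 3 * R" for w z
  proof -
    have "norm (g w z - g 0 0) \<le> L * (norm w + norm z)" using L(2)[of w z 0 0] that R0 by simp
    also have "\<dots> \<le> L * (6 * R)" using that L(1) by (intro mult_left_mono) auto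
    finally show ?thesis
      using norm_triangle_sub[of "g w z" "g 0 0"] by (simp add: G_def)
  qed
  have N_cont: "continuous_on UNIV N"
  proof -
    have "isCont N u" for u
    proof -
      obtain LN where "LN-lipschitz_on (cball u 1) N"
        using locally_lipschitz_imp_lipschitz_compact[OF N_loclip compact_cball] by blast
      then have "continuous_on (ball u 1) N"
        by (meson ball_subset_cball continuous_on_subset lipschitz_on_continuous_on)
      then show ?thesis by (simp add: continuous_on_eq_continuous_at)
    qed
    then show ?thesis by (simp add: continuous_at_imp_continuous_on)
  qed
  have P_cont: "continuous_on UNIV (P1 :: ('a \<times> 'a) \<times> (real \<times> real) \<Rightarrow> 'a \<times> real)"
      "continuous_on UNIV (P2 :: ('a \<times> 'a) \<times> (real \<times> real) \<Rightarrow> 'a \<times> real)"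
    unfolding P1_def[abs_def] P2_def[abs_def] by (intro continuous_intros)+
  note P_meas = P_cont[THEN borel_measurable_continuous_onI]
  have T_meas: "T k \<in> borel_measurable borel" if "0 < k" for k
    unfolding T_def using bdf2_map_continuous[OF A_lin A_nonneg that less_imp_le[OF gamma_pos] N_cont]
    by (rule borel_measurable_continuous_onI)
  have P1_T: "P1 (T k x) = P2 x" if "0 < k" for k x
    unfolding T_def by (rule P1_bdf2_map[OF A_lin A_nonneg that less_imp_le[OF gamma_pos]])
  have step: "3 *\<^sub>R P2 (T k x) - 4 *\<^sub>R P2 x + P1 x = (2 * k) *\<^sub>R g (2 *\<^sub>R P2 x - P1 x) (P2 (T k x))"
    if "0 < k" for k x
    using bdf2_map_eq[OF A_lin A_nonneg that less_imp_le[OF gamma_pos], of N F x]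
    unfolding T_def g_def sav_field_def Let_def .
  have T_inv: "invariant_map (T k) (\<mu> k)" if "0 < k" "k \<le> 1" for k
    unfolding T_def using mu_inv that by simp
  have bounded: "AE x in \<mu> k. norm (P1 x) \<le> R \<and> norm (P2 x) \<le> R" if "0 < k" "k \<le> 1" for k
    by (rule bdf2_invariant_bounded[OF T_inv[OF that] T_meas[OF that(1)] P_meas P1_T[OF that(1)]
          step[OF that(1)] diss c that R_def])
  have increment: "AE x in \<mu> k. norm (P2 x - P1 x) \<le> G * k" if "0 < k" "k \<le> 1" for k
    by (rule bdf2_invariant_increment[OF T_inv[OF that] T_meas[OF that(1)] P_meas P1_T[OF that(1)]
          step[OF that(1)] bounded[OF that] G that(1)])
  define Y :: "('a \<times> 'a) \<times> (real \<times> real) \<Rightarrow> 'a \<times> real"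
    where "Y x = (3/2) *\<^sub>R P2 x - (1/2) *\<^sub>R P1 x" for x
  have Y_cont: "continuous_on UNIV Y"
    unfolding Y_def[abs_def] by (intro continuous_intros P_cont)
  have Y_le: "norm (Y x) \<le> 2 * R" if "norm (P1 x) \<le> R" "norm (P2 x) \<le> R" for x
    using that norm_triangle_ineq4[of "(3/2) *\<^sub>R P2 x" "(1/2) *\<^sub>R P1 x"] by (simp add: Y_def)
  have Y_bounded: "AE x in \<mu> k. norm (Y x) \<le> 2 * R" if "0 < k" "k \<le> 1" for k
    using bounded[OF that] by eventually_elim (simp add: Y_le)
  have consistent: "AE x in \<mu> k. norm (Y (T k x) - Y x - k *\<^sub>R g (Y x) (Y x)) \<le> 2 * L * G * k\<^sup>2"
    if k: "0 < k" "k \<le> 1" for k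
    using bounded[OF k] invariant_map_AE_compose[OF T_inv[OF k] T_meas[OF k(1)] bounded[OF k]]
      increment[OF k] invariant_map_AE_compose[OF T_inv[OF k] T_meas[OF k(1)] increment[OF k]]
  proof eventually_elim
    fix x assume b: "norm (P1 x) \<le> R \<and> norm (P2 x) \<le> R"
      "norm (P1 (T k x)) \<le> R \<and> norm (P2 (T k x)) \<le> R"
      and i: "norm (P2 x - P1 x) \<le> G * k" "norm (P2 (T k x) - P1 (T k x)) \<le> G * k"
    have w: "norm (2 *\<^sub>R P2 x - P1 x) \<le> 3 * R"
      using b(1) norm_triangle_ineq4[of "2 *\<^sub>R P2 x" "P1 x"] by simp
    have "norm (Y x) \<le> 3 * R" using Y_le[of x] b(1) R0 by simp
    moreover have "norm (P2 (T k x)) \<le> 3 * R" using b(2) R0 by simp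
    ultimately have lip_Y: "norm (g (2 *\<^sub>R P2 x - P1 x) (P2 (T k x)) - g (Y x) (Y x))
        \<le> L * (norm (2 *\<^sub>R P2 x - P1 x - Y x) + norm (P2 (T k x) - Y x))"
      using w by (intro L(2))
    show "norm (Y (T k x) - Y x - k *\<^sub>R g (Y x) (Y x)) \<le> 2 * L * G * k\<^sup>2"
      using bdf2_consistency[where g=g, OF step[OF k(1)] i(1) i(2)[unfolded P1_T[OF k(1)]] k(1)
          Y_def lip_Y L(1)]
      by (simp add: P1_T[OF k(1)] Y_def[of "T k x"])
  qed
  define \<kappa> where "\<kappa> n = 1 / real (Suc n)" for n
  have \<kappa>: "0 < \<kappa> n" "\<kappa> n \<le> 1" for n by (auto simp: \<kappa>_def)
  have \<kappa>_lim: "\<kappa> \<longlonglongrightarrow> 0" unfolding \<kappa>_def by (rule LIMSEQ_Suc[OF lim_1_over_n])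
  have \<mu>: "borel_prob (\<mu> k)" if "0 < k" "k \<le> 1" for k
    using T_inv[OF that] by (simp add: invariant_map_def)
  define K :: "(('a \<times> 'a) \<times> (real \<times> real)) set"
    where "K = (cball 0 R \<times> cball 0 R) \<times> (cball 0 R \<times> cball 0 R)"
  have "compact K" unfolding K_def by (intro compact_Times compact_cball)
  moreover have "AE x in \<mu> (\<kappa> n). x \<in> K" for n
    using bounded[OF \<kappa>[of n]]
  proof eventually_elim
    fix x :: "('a \<times> 'a) \<times> (real \<times> real)" assume x: "norm (P1 x) \<le> R \<and> norm (P2 x) \<le> R"
    obtain u0 u1 q0 q1 where "x = ((u0, u1), (q0, q1))" by (metis prod.collapse)
    then show "x \<in> K"
      using x norm_fst_le[of u0 q0] norm_snd_le[of q0 u0] norm_fst_le[of u1 q1] norm_snd_le[of q1 u1]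
      by (simp add: K_def P1_def P2_def)
  qed
  ultimately obtain r \<mu>0 where r: "strict_mono (r :: nat \<Rightarrow> nat)" and \<mu>0: "borel_prob \<mu>0"
    and conv: "weak_conv (\<lambda>n. \<mu> (\<kappa> (r n))) \<mu>0"
    using weak_conv_subsequence_compact[of "\<lambda>n. \<mu> (\<kappa> n)" K] \<mu>[OF \<kappa>] by metis
  define kn where "kn n = \<kappa> (r n)" for n
  have kn: "0 < kn n" "kn n \<le> 1" for n unfolding kn_def by (rule \<kappa>)+
  have kn_lim: "kn \<longlonglongrightarrow> 0"
    using LIMSEQ_subseq_LIMSEQ[OF \<kappa>_lim r] by (simp add: kn_def[abs_def] comp_def)
  note conv = conv[folded kn_def]
  have Sq_ode': "((\<lambda>s. Sq s z) has_vector_derivative g (Sq t z) (Sq t z)) (at t within {0..})"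
    if "0 \<le> t" for t z
    unfolding g_def sav_field_def by (rule Sq_ode[OF that])
  have inv_Y: "invariant_semigroup Sq (distr \<mu>0 borel Y)"
    by (rule weak_limit_invariant_semigroup[OF Sq_init Sq_ode' diss' lip Y_cont conv \<mu>0
          T_inv[OF kn] T_meas[OF kn(1)] Y_bounded[OF kn] consistent[OF kn] kn(1) kn_lim])
  have "AE x in \<mu>0. norm (P2 x - P1 x) = 0"
  proof (rule weak_conv_AE_zero[OF conv \<mu>[OF kn] \<mu>0])
    show "continuous_on UNIV (\<lambda>x::('a \<times> 'a) \<times> (real \<times> real). norm (P2 x - P1 x))"
      by (intro continuous_intros P_cont)
    show "AE x in \<mu> (kn n). norm (P2 x - P1 x) \<le> G * kn n" for n by (rule increment[OF kn])
    show "(\<lambda>n. G * kn n) \<longlonglongrightarrow> 0" using tendsto_mult_left[OF kn_lim, of G] by simp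
  qed simp
  then have P_eq: "AE x in \<mu>0. P1 x = P2 x" by eventually_elim simp
  have P_Y: "distr \<mu>0 borel P = distr \<mu>0 borel Y" if "P \<in> {P1, P2}" for P
  proof (rule distr_cong_AE)
    show "AE x in \<mu>0. P x = Y x"
      using P_eq
    proof eventually_elim
      fix x :: "('a \<times> 'a) \<times> (real \<times> real)" assume eq: "P1 x = P2 x"
      have "Y x = P2 x"
        unfolding Y_def eq using scaleR_diff_left[of "3/2" "1/2" "P2 x"] by simp
      then show "P x = Y x" using eq that by auto
    qed
    show "P \<in> borel_measurable \<mu>0" "Y \<in> borel_measurable \<mu>0"
      using that P_meas borel_measurable_continuous_onI[OF Y_cont] borel_probD[OF \<mu>0]
        measurable_cong_sets[of \<mu>0 borel borel borel] by auto
  qed auto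
  have Sq_cont: "continuous_on UNIV (Sq t)" if "0 \<le> t" for t
    by (rule flow_continuous[OF Sq_init Sq_ode' diss' lip that])
  have Pu_cont: "continuous_on UNIV (Pu :: 'a \<times> real \<Rightarrow> 'a)"
    unfolding Pu_def[abs_def] by (intro continuous_intros)
  have "invariant_semigroup Sq (distr \<mu>0 borel P) \<and>
      weak_conv (\<lambda>n. distr (distr (\<mu> (kn n)) borel P) borel Pu) (distr (distr \<mu>0 borel P) borel Pu) \<and>
      invariant_semigroup S (distr (distr \<mu>0 borel P) borel Pu)" if P: "P \<in> {P1, P2}" for P
  proof (intro conjI)
    show inv_P: "invariant_semigroup Sq (distr \<mu>0 borel P)" using P_Y[OF P] inv_Y by simp
    have Pc: "continuous_on UNIV P" using P P_cont by auto
    have distr_P: "borel_prob (distr \<nu> borel P)" if "borel_prob \<nu>" for \<nu>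
      by (rule borel_prob_distr[OF that borel_measurable_continuous_onI[OF Pc]])
    show "weak_conv (\<lambda>n. distr (distr (\<mu> (kn n)) borel P) borel Pu) (distr (distr \<mu>0 borel P) borel Pu)"
      by (intro weak_conv_distr conv distr_P \<mu>[OF kn] \<mu>0 Pc Pu_cont)
    show "invariant_semigroup S (distr (distr \<mu>0 borel P) borel Pu)"
      by (rule invariant_semigroup_projection[OF N_orth gamma_pos S_init S_ode Sq_init
            Sq_ode'[unfolded g_def] lip[unfolded g_def] Sq_cont inv_P])
  qed
  then show ?thesis using kn kn_lim \<mu>0 conv by (intro exI[of _ kn] exI[of _ \<mu>0]) auto
qed

end
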